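(* Let $\theta$ be a primitive aperiodic bijective substitution of constant length $r$ over a finite alphabet $\mathcal{A}$, in canonical form, with $n$ (bi-infinite) fixed points, such that the collection $\{P(i,j,k)\}$ partitions the set $P_\theta$ of $\theta$-legal two-letter words. Then the Ellis semigroup $E(X_\theta,\sigma)$ has exactly $2$ minimal ideals, and each of them contains exactly $q$ idempotents, where $q=|\{C_i : 1\le i\le r-1\}|$ is the number of distinct sets among $C_1,\dots,C_{r-1}$.
   Context: Words are indexed from $0$: $\theta(a)=\theta(a)_0\theta(a)_1\ldots\theta(a)_{r-1}$. The alphabet $\mathcal{A}$ is $\{0,1,\dots,s\}$ for some $s$. A substitution $\theta:\mathcal{A}\to\mathcal{A}^{<\mathbb{N}}$ is extended to finite and bi-infinite words by concatenation (keeping the origin fixed: $\theta(\ldots x_{-1}\cdot x_0\ldots)=\ldots\theta(x_{-1})\cdot\theta(x_0)\ldots$). It has constant length $r$ if $|\theta(a)|=r$ for all $a$. It is aperiodic if its fixed point is not periodic under the shift and $\theta(a)\ne\theta(b)$ for $a\neq b$. It is bijective if $\theta(a)_m\ne\theta(b)_m$ for all letters $a\ne b$ and all $0\le m\le r-1$. It is in canonical form if $\theta(a)_0=\theta(a)_{r-1}=a$ for every letter $a$. $\sigma$ is the shift $\sigma(x)_m=x_{m+1}$, and $X_\theta\subset\mathcal{A}^{\mathbb{Z}}$ is the orbit closure of a bi-infinite fixed point of $\theta$ (for primitive $\theta$: the set of bi-infinite words all of whose finite subwords occur in some $\theta^k(a)$; independent of the fixed point). Fixed points are understood to lie in $X_\theta$.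 A finite word is $\theta$-legal if it occurs in some element of $X_\theta$; $P_\theta$ is the set of $\theta$-legal two-letter words. Height: let $x$ be a bi-infinite fixed point of $\theta$ with $x_0=0$, $M=\{m\ge 1:x_m=0\}$, $d_\theta=\gcd M$; then $h(\theta)=\max\{m\ge1:\gcd(m,r)=1,\ m\mid d_\theta\}$. Letter classes: for $a\in\mathcal{A}$ let $z(a)$ be the residue mod $h(\theta)$ of the least $m\ge0$ such that $\theta^k(a)_m=0$ for some $k\ge 1$. For $p\in\{0,\dots,h(\theta)-1\}$, $S_p=\{a\in\mathcal{A}: z(a)\equiv -p \bmod h(\theta)\}$. For $0\le i\le h(\theta)-1$, $k\ge1$, $0\le j\le r^k-2$, $P(i,j,k)=\{\theta^k(a)_j\theta^k(a)_{j+1}: a\in S_i\}$. The collection partitions $P_\theta$ if any two of these sets are equal or disjoint and their union is $P_\theta$. Substitution $\phi$: label the distinct sets $P(i,j,k)$ as $P_0,\dots,P_{N-1}$ so that the last letters of the words in $P_0$ belong to $S_0$, and for $ab\in P_\theta$ let $[ab]$ be the index $m$ with $ab\in P_m$. Let $\mathcal{B}=\{0,\dots,N-1\}$. For $b\in\mathcal{B}$ let $a_b$ be any last letter of a word in $P_b$; then $\phi(b)=b_0b_1\ldots b_{r-1}$ with $b_0=b$ and $b_m=[\theta(a_b)_{m-1}\theta(a_b)_m]$ for $1\le m\le r-1$ (independent of the choice of $a_b$). For $1\le i\le r-1$, $C_i=\{\phi(b)_i:b\in\mathcal{B}\}$. The Ellis semigroup $E(X,\sigma)$ is the closure of $\{\sigma^m:m\in\mathbb{Z}\}$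 in $X^X$ with the product topology, a semigroup under composition. An ideal is a nonempty $I\subset E$ with $EI\subset I$ (left ideal); it is minimal if it contains no proper ideal. An idempotent is $u$ with $u^2=u$. *)

theory Defs
  imports
    "HOL-Analysis.Analysis"
    "HOL-Library.Sublist"
    "HOL-Number_Theory.Cong"
begin

text \<open>
  The alphabet is \<open>{0..s}\<close>. A substitution is a map \<open>\<theta> :: nat \<Rightarrow> nat list\<close> of which only the
  values on the alphabet matter. Finite words are lists, bi-infinite words are functions
  \<open>int \<Rightarrow> nat\<close>.
\<close>

definition substitution :: "nat \<Rightarrow> (nat \<Rightarrow> nat list) \<Rightarrow> bool" where
  "substitution s \<theta> \<longleftrightarrow> (\<forall>a\<in>{0..s}. set (\<theta> a) \<subseteq> {0..s})"

definition constant_length :: "nat \<Rightarrow> nat \<Rightarrow> (nat \<Rightarrow> nat list) \<Rightarrow> bool" where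
  "constant_length s r \<theta> \<longleftrightarrow> (\<forall>a\<in>{0..s}. length (\<theta> a) = r)"

definition subst_word :: "(nat \<Rightarrow> nat list) \<Rightarrow> nat list \<Rightarrow> nat list" where
  "subst_word \<theta> w = concat (map \<theta> w)"

definition subst_iter :: "(nat \<Rightarrow> nat list) \<Rightarrow> nat \<Rightarrow> nat \<Rightarrow> nat list" where
  "subst_iter \<theta> k a = (subst_word \<theta> ^^ k) [a]"

text \<open>
  For a substitution of constant length \<open>r\<close>, concatenating the words \<open>\<theta> (x m)\<close> with the origin
  fixed puts \<open>\<theta> (x m)\<close> at the positions \<open>r * m, \<dots>, r * m + r - 1\<close>; \<open>div\<close> and \<open>mod\<close> on
  \<open>int\<close> round towards minus infinity.
\<close>

definition subst_bi :: "nat \<Rightarrow> (nat \<Rightarrow> nat list) \<Rightarrow> (int \<Rightarrow> nat) \<Rightarrow> (int \<Rightarrow> nat)" where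
  "subst_bi r \<theta> x = (\<lambda>m. \<theta> (x (m div int r)) ! nat (m mod int r))"

text \<open>The integer power \<open>\<sigma>\<^sup>m\<close> of the shift \<open>\<sigma>(x)\<^sub>i = x\<^sub>i\<^sub>+\<^sub>1\<close>.\<close>

definition shift_pow :: "int \<Rightarrow> (int \<Rightarrow> nat) \<Rightarrow> (int \<Rightarrow> nat)" where
  "shift_pow m x = (\<lambda>i. x (i + m))"

definition subword :: "(int \<Rightarrow> nat) \<Rightarrow> int \<Rightarrow> nat \<Rightarrow> nat list" where
  "subword x m l = map (\<lambda>i. x (m + int i)) [0..<l]"

definition subst_space :: "nat \<Rightarrow> (nat \<Rightarrow> nat list) \<Rightarrow> (int \<Rightarrow> nat) set" where
  "subst_space s \<theta> = {x. \<forall>m l. \<exists>k. \<exists>a\<in>{0..s}. sublist (subword x m l) (subst_iter \<theta> k a)}"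

definition fixed_points :: "nat \<Rightarrow> nat \<Rightarrow> (nat \<Rightarrow> nat list) \<Rightarrow> (int \<Rightarrow> nat) set" where
  "fixed_points s r \<theta> = {x \<in> subst_space s \<theta>. subst_bi r \<theta> x = x}"

definition primitive :: "nat \<Rightarrow> (nat \<Rightarrow> nat list) \<Rightarrow> bool" where
  "primitive s \<theta> \<longleftrightarrow> (\<exists>k\<ge>1. \<forall>a\<in>{0..s}. \<forall>b\<in>{0..s}. b \<in> set (subst_iter \<theta> k a))"

definition shift_periodic :: "(int \<Rightarrow> nat) \<Rightarrow> bool" where
  "shift_periodic x \<longleftrightarrow> (\<exists>p\<ge>1. shift_pow p x = x)"

text \<open>
  Requiring a fixed point to exist excludes the degenerate length \<open>r = 1\<close>, for which
  \<^const>\<open>subst_space\<close> is empty.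
\<close>

definition aperiodic :: "nat \<Rightarrow> nat \<Rightarrow> (nat \<Rightarrow> nat list) \<Rightarrow> bool" where
  "aperiodic s r \<theta> \<longleftrightarrow>
     fixed_points s r \<theta> \<noteq> {} \<and> (\<forall>x\<in>fixed_points s r \<theta>. \<not> shift_periodic x) \<and> inj_on \<theta> {0..s}"

definition bijective :: "nat \<Rightarrow> nat \<Rightarrow> (nat \<Rightarrow> nat list) \<Rightarrow> bool" where
  "bijective s r \<theta> \<longleftrightarrow>
     (\<forall>a\<in>{0..s}. \<forall>b\<in>{0..s}. a \<noteq> b \<longrightarrow> (\<forall>m<r. \<theta> a ! m \<noteq> \<theta> b ! m))"

definition canonical_form :: "nat \<Rightarrow> nat \<Rightarrow> (nat \<Rightarrow> nat list) \<Rightarrow> bool" where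
  "canonical_form s r \<theta> \<longleftrightarrow> (\<forall>a\<in>{0..s}. \<theta> a ! 0 = a \<and> \<theta> a ! (r - 1) = a)"

definition legal :: "nat \<Rightarrow> (nat \<Rightarrow> nat list) \<Rightarrow> nat list \<Rightarrow> bool" where
  "legal s \<theta> w \<longleftrightarrow> (\<exists>x\<in>subst_space s \<theta>. \<exists>m. subword x m (length w) = w)"

definition legal_pairs :: "nat \<Rightarrow> (nat \<Rightarrow> nat list) \<Rightarrow> nat list set" where
  "legal_pairs s \<theta> = {w. length w = 2 \<and> legal s \<theta> w}"

text \<open>
  The choice of the fixed point is immaterial: the letters to the right of the origin are
  determined by \<open>x 0 = 0\<close>.
\<close>

definition height :: "nat \<Rightarrow> nat \<Rightarrow> (nat \<Rightarrow> nat list) \<Rightarrow> nat" where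
  "height s r \<theta> =
     (let x = (SOME x. x \<in> fixed_points s r \<theta> \<and> x 0 = 0);
          d = Gcd {m::nat. m \<ge> 1 \<and> x (int m) = 0}
      in Max {m. m \<ge> 1 \<and> coprime m r \<and> m dvd d})"

definition letter_residue :: "nat \<Rightarrow> nat \<Rightarrow> (nat \<Rightarrow> nat list) \<Rightarrow> nat \<Rightarrow> nat" where
  "letter_residue s r \<theta> a =
     (LEAST m. \<exists>k\<ge>1. m < length (subst_iter \<theta> k a) \<and> subst_iter \<theta> k a ! m = 0)
       mod height s r \<theta>"

definition letter_class :: "nat \<Rightarrow> nat \<Rightarrow> (nat \<Rightarrow> nat list) \<Rightarrow> nat \<Rightarrow> nat set" where
  "letter_class s r \<theta> p =
     {a\<in>{0..s}. [int (letter_residue s r \<theta> a) = - int p] (mod int (height s r \<theta>))}"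

definition pair_set :: "nat \<Rightarrow> nat \<Rightarrow> (nat \<Rightarrow> nat list) \<Rightarrow> nat \<Rightarrow> nat \<Rightarrow> nat \<Rightarrow> nat list set" where
  "pair_set s r \<theta> i j k =
     {[subst_iter \<theta> k a ! j, subst_iter \<theta> k a ! (j + 1)] | a. a \<in> letter_class s r \<theta> i}"

text \<open>The bound \<open>j \<le> r\<^sup>k - 2\<close> is written without truncated subtraction.\<close>

definition pair_sets :: "nat \<Rightarrow> nat \<Rightarrow> (nat \<Rightarrow> nat list) \<Rightarrow> nat list set set" where
  "pair_sets s r \<theta> =
     {pair_set s r \<theta> i j k | i j k. i < height s r \<theta> \<and> k \<ge> 1 \<and> j + 2 \<le> r ^ k}"

definition pair_sets_partition :: "nat \<Rightarrow> nat \<Rightarrow> (nat \<Rightarrow> nat list) \<Rightarrow> bool" where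
  "pair_sets_partition s r \<theta> \<longleftrightarrow>
     pairwise disjnt (pair_sets s r \<theta>) \<and> \<Union> (pair_sets s r \<theta>) = legal_pairs s \<theta>"

text \<open>
  \<open>P 0, \<dots>, P (N - 1)\<close> is an admissible labelling of the distinct pair sets, and \<open>c b\<close> is a
  chosen last letter of a word in \<open>P b\<close>.
\<close>

definition pair_labelling ::
  "nat \<Rightarrow> nat \<Rightarrow> (nat \<Rightarrow> nat list) \<Rightarrow> nat \<Rightarrow> (nat \<Rightarrow> nat list set) \<Rightarrow> bool" where
  "pair_labelling s r \<theta> N P \<longleftrightarrow>
     bij_betw P {..<N} (pair_sets s r \<theta>) \<and> last ` P 0 \<subseteq> letter_class s r \<theta> 0"

definition last_letter_choice :: "nat \<Rightarrow> (nat \<Rightarrow> nat list set) \<Rightarrow> (nat \<Rightarrow> nat) \<Rightarrow> bool" where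
  "last_letter_choice N P c \<longleftrightarrow> (\<forall>b<N. c b \<in> last ` P b)"

definition pair_index :: "nat \<Rightarrow> (nat \<Rightarrow> nat list set) \<Rightarrow> nat list \<Rightarrow> nat" where
  "pair_index N P w = (THE m. m < N \<and> w \<in> P m)"

definition pair_subst ::
  "nat \<Rightarrow> (nat \<Rightarrow> nat list) \<Rightarrow> nat \<Rightarrow> (nat \<Rightarrow> nat list set) \<Rightarrow> (nat \<Rightarrow> nat) \<Rightarrow> nat \<Rightarrow> nat list" where
  "pair_subst r \<theta> N P c b =
     b # map (\<lambda>m. pair_index N P [\<theta> (c b) ! (m - 1), \<theta> (c b) ! m]) [1..<r]"

definition column_set ::
  "nat \<Rightarrow> (nat \<Rightarrow> nat list) \<Rightarrow> nat \<Rightarrow> (nat \<Rightarrow> nat list set) \<Rightarrow> (nat \<Rightarrow> nat) \<Rightarrow> nat \<Rightarrow> nat set" where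
  "column_set r \<theta> N P c i = {pair_subst r \<theta> N P c b ! i | b. b < N}"

text \<open>
  Self-maps of \<open>X\<close> are represented by functions that are \<open>undefined\<close> outside \<open>X\<close>, so that
  \<open>X \<rightarrow>\<^sub>E X\<close>, the carrier of the product topology, is \<open>X\<^sup>X\<close>. On \<open>int \<Rightarrow> nat\<close> the topology of the
  type class is the product of the discrete topologies.
\<close>

definition ellis_semigroup ::
  "'x::topological_space set \<Rightarrow> (int \<Rightarrow> 'x \<Rightarrow> 'x) \<Rightarrow> ('x \<Rightarrow> 'x) set" where
  "ellis_semigroup X T =
     product_topology (\<lambda>_. top_of_set X) X closure_of {restrict (T m) X | m. True}"

definition left_ideal :: "'x set \<Rightarrow> ('x \<Rightarrow> 'x) set \<Rightarrow> ('x \<Rightarrow> 'x) set \<Rightarrow> bool" where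
  "left_ideal X E I \<longleftrightarrow> I \<noteq> {} \<and> I \<subseteq> E \<and> (\<forall>f\<in>E. \<forall>g\<in>I. compose X f g \<in> I)"

definition minimal_left_ideals :: "'x set \<Rightarrow> ('x \<Rightarrow> 'x) set \<Rightarrow> ('x \<Rightarrow> 'x) set set" where
  "minimal_left_ideals X E = {I. left_ideal X E I \<and> \<not> (\<exists>J. left_ideal X E J \<and> J \<subset> I)}"

definition idempotents :: "'x set \<Rightarrow> ('x \<Rightarrow> 'x) set \<Rightarrow> ('x \<Rightarrow> 'x) set" where
  "idempotents X I = {u\<in>I. compose X u u = u}"

end

theory Submission
  imports Defs
begin

text \<open>
  Call \<open>t\<close> a boundary of level \<open>k\<close> of \<open>x\<close> if \<open>\<sigma>\<^sup>t x = \<theta>\<^sup>k y\<close> for some \<open>y\<close> in \<open>X\<close>. Canonical form and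
  bijectivity make the boundaries of each level a single residue class modulo \<open>r\<^sup>k\<close>; this is the
  map to the odometer. On a block between consecutive boundaries, two points of
  one fibre agree everywhere or nowhere; hence, on each side of the origin, eventually everywhere or eventually nowhere.

  Therefore a limit \<open>f\<close> of shifts \<open>\<sigma>\<^sup>m\<close> with \<open>m \<rightarrow> \<infinity>\<close> that preserves fibres factors, on each fibre, through
  one far coordinate, on which it acts by a permutation of letters. So \<open>f\<close> has an idempotent power \<open>u\<close>, and
  \<open>g u = g\<close> for every such limit \<open>g\<close>. Hence the limits with \<open>m \<rightarrow> \<infinity>\<close> form a minimal left ideal, as do
  those with \<open>m \<rightarrow> -\<infinity>\<close>, and there are no others.

  An idempotent is determined by the fixed points in its image. Their central pairs form one of
  the sets \<open>{\<theta>(a)\<^sub>t\<^sub>-\<^sub>1 \<theta>(a)\<^sub>t}\<close> with \<open>1 \<le> t < r\<close>, and every such set occurs. The partition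
  hypothesis matches it with \<open>C\<^sub>t\<close>.
\<close>

text \<open>Fibres are of two kinds. If no integer is a boundary of every level, any two positions
  lie in one block of some level, so points of the fibre that agree at one position are equal, and
  an idempotent, which preserves the fibre and a far tail, is the identity there. If some integer is
  such a boundary, the point is a shift of a fixed point, and the words to the left and to the right
  of that integer grow independently from one letter each. So up to shifts an idempotent acts
  nontrivially only on the finite set of fixed points: it keeps the letter on the side to which its
  shifts run, and the pairs in its image dictate the letter on the other side. A general element of
  E does not preserve fibres but rotates the odometer; inside a left ideal the rotation is undone by
  composing with a limit of shifts by the opposite residues. Aperiodicity enters through one fact: a
  letter does not determine its successor. This makes boundaries unique and also separates the two
  ideals.\<close>

text \<open>If each e failed at some level \<kappa>(e), all would fail at the sum of these levels.
  This is the compactness argument that turns a choice made separately at each level into one choice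
  valid at all levels.\<close>

lemma finite_antitone_choice:
  fixes P :: "nat \<Rightarrow> 'a \<Rightarrow> bool"
  assumes "finite B" and ex: "\<And>k. \<exists>e\<in>B. P k e"
    and anti: "\<And>j k e. j \<le> k \<Longrightarrow> P k e \<Longrightarrow> P j e"
  shows "\<exists>e\<in>B. \<forall>k. P k e"
proof (rule ccontr)
  assume "\<not> ?thesis"
  then obtain \<kappa> where \<kappa>: "\<And>e. e \<in> B \<Longrightarrow> \<not> P (\<kappa> e) e" by metis
  obtain e where e: "e \<in> B" "P (sum \<kappa> B) e" using ex by blast
  have "\<kappa> e \<le> sum \<kappa> B" using e(1) assms(1) by (simp add: member_le_sum)
  then show False using anti e \<kappa> by blast
qed

lemma nth_concat_const:
  assumes "\<And>x. x \<in> set xs \<Longrightarrow> length (f x) = r" and "i < r * length xs"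
  shows "concat (map f xs) ! i = f (xs ! (i div r)) ! (i mod r)"
  using assms
proof (induction xs arbitrary: i)
  case (Cons x xs)
  show ?case
  proof (cases "i < r")
    case True
    then show ?thesis using Cons.prems by (simp add: nth_append)
  next
    case False
    then have "r > 0" "i \<ge> r" using Cons.prems by (cases "r = 0"; simp)+
    then have "i div r = Suc ((i - r) div r)" "i mod r = (i - r) mod r"
      by (simp_all add: le_div_geq le_mod_geq)
    moreover have "i - r < r * length xs" using Cons.prems \<open>i \<ge> r\<close> by simp
    ultimately show ?thesis using Cons \<open>i \<ge> r\<close> by (simp add: nth_append)
  qed
qed simp

lemma sublist_iff_nth:
  "sublist us vs \<longleftrightarrow> (\<exists>p. p + length us \<le> length vs \<and> (\<forall>i<length us. us ! i = vs ! (p + i)))"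
proof
  assume "sublist us vs"
  then obtain ps ss where "vs = ps @ us @ ss" by (auto simp: sublist_def)
  then show "\<exists>p. p + length us \<le> length vs \<and> (\<forall>i<length us. us ! i = vs ! (p + i))"
    by (intro exI[of _ "length ps"]) (auto simp: nth_append)
next
  assume "\<exists>p. p + length us \<le> length vs \<and> (\<forall>i<length us. us ! i = vs ! (p + i))"
  then obtain p where p: "p + length us \<le> length vs" "\<forall>i<length us. us ! i = vs ! (p + i)" by blast
  then have "us = take (length us) (drop p vs)" by (intro nth_equalityI) auto
  then show "sublist us vs" by (metis sublist_drop sublist_order.order_trans sublist_take)
qed

text \<open>Pigeonhole puts b on a cycle of length at most s + 1, and every such length divides (s +
  1)!. The exponent depends on neither \<rho> nor b, so one power serves all fibres at once.\<close>

lemma funpow_fact_id: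
  fixes \<rho> :: "nat \<Rightarrow> nat"
  assumes "\<rho> ` B \<subseteq> B" and "inj_on \<rho> B" and "B \<subseteq> {0..s}" and "b \<in> B"
  shows "(\<rho> ^^ fact (Suc s)) b = b"
proof -
  have mem: "(\<rho> ^^ n) b \<in> B" for n by (induction n) (use assms in auto)
  have "\<not> inj_on (\<lambda>n. (\<rho> ^^ n) b) {0..Suc s}"
  proof
    assume "inj_on (\<lambda>n. (\<rho> ^^ n) b) {0..Suc s}"
    then have "card {0..Suc s} \<le> card {0..s}"
      using mem assms(3) by (intro card_inj_on_le) auto
    then show False by simp
  qed
  then obtain i j where ij: "i < j" "j \<le> Suc s" "(\<rho> ^^ i) b = (\<rho> ^^ j) b"
    unfolding inj_on_def by (metis atLeastAtMost_iff linorder_neqE_nat)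
  have cancel: "b' = b''" if "(\<rho> ^^ i) b' = (\<rho> ^^ i) b''" "b' \<in> B" "b'' \<in> B" for b' b'' i
    using that
  proof (induction i arbitrary: b' b'')
    case (Suc i)
    then have "\<rho> b' = \<rho> b''" using assms(1) by (auto simp: funpow_swap1)
    then show ?case using Suc.prems assms(2) by (auto dest: inj_onD)
  qed simp
  have "(\<rho> ^^ i) b = (\<rho> ^^ i) ((\<rho> ^^ (j - i)) b)"
    using ij(1,3) by (metis funpow_add le_add_diff_inverse less_imp_le o_apply)
  then have per: "(\<rho> ^^ (j - i)) b = b" using cancel mem assms(4) by metis
  have "(j - i) dvd fact (Suc s)" using ij(1,2) by (intro dvd_fact) auto
  then obtain q where "fact (Suc s) = (j - i) * q" by (auto elim: dvdE)
  moreover have "(\<rho> ^^ ((j - i) * q)) b = b"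
  proof (induction q)
    case (Suc q)
    then show ?case using per by (simp add: funpow_add)
  qed simp
  ultimately show ?thesis by simp
qed

section \<open>Blocks of the iterated substitution\<close>

text \<open>For 0 <= i < r^k this is letter i of \<theta>^k(a). It is total in an integer position,
  so that \<open>div\<close> and \<open>mod\<close> split positions without length
  conditions.\<close>

primrec block :: "nat \<Rightarrow> (nat \<Rightarrow> nat list) \<Rightarrow> nat \<Rightarrow> nat \<Rightarrow> int \<Rightarrow> nat" where
  "block r \<theta> 0 a i = a"
| "block r \<theta> (Suc k) a i = \<theta> (block r \<theta> k a (i div int r)) ! nat (i mod int r)"

locale canonical_bijective_substitution =
  fixes s r :: nat and \<theta> :: "nat \<Rightarrow> nat list"
  assumes substitution: "substitution s \<theta>"
    and constant_length: "constant_length s r \<theta>"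
    and primitive: "primitive s \<theta>"
    and aperiodic: "aperiodic s r \<theta>"
    and bijective: "bijective s r \<theta>"
    and canonical: "canonical_form s r \<theta>"
begin

abbreviation X where "X \<equiv> subst_space s \<theta>"
abbreviation F where "F \<equiv> fixed_points s r \<theta>"
abbreviation W where "W \<equiv> block r \<theta>"

definition R :: "nat \<Rightarrow> int" where
  "R k = int (r ^ k)"

text \<open>The extension of \<theta>^k to bi-infinite words with the origin fixed; k = 1 gives
  \<open>subst_bi\<close>.\<close>

definition inflate :: "nat \<Rightarrow> (int \<Rightarrow> nat) \<Rightarrow> (int \<Rightarrow> nat)" where
  "inflate k y = (\<lambda>m. W k (y (m div R k)) (m mod R k))"

definition agree :: "nat \<Rightarrow> (int \<Rightarrow> nat) \<Rightarrow> (int \<Rightarrow> nat) \<Rightarrow> bool" where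
  "agree L x y \<longleftrightarrow> (\<forall>i. \<bar>i\<bar> \<le> int L \<longrightarrow> x i = y i)"

definition boundary :: "nat \<Rightarrow> (int \<Rightarrow> nat) \<Rightarrow> int \<Rightarrow> bool" where
  "boundary k x t \<longleftrightarrow> (\<exists>y\<in>X. shift_pow t x = inflate k y)"

lemma subst_iter_0: "subst_iter \<theta> 0 a = [a]"
  by (simp add: subst_iter_def)

lemma subst_iter_Suc: "subst_iter \<theta> (Suc k) a = concat (map \<theta> (subst_iter \<theta> k a))"
  by (simp add: subst_iter_def subst_word_def)

lemma subst_iter_letters: "a \<le> s \<Longrightarrow> set (subst_iter \<theta> k a) \<subseteq> {0..s}"
proof (induction k)
  case (Suc k)
  then show ?case using substitution
    unfolding subst_iter_Suc substitution_def by fastforce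
qed (simp add: subst_iter_0)

lemma length_subst_iter: "a \<le> s \<Longrightarrow> length (subst_iter \<theta> k a) = r ^ k"
proof (induction k)
  case (Suc k)
  have *: "map (length \<circ> \<theta>) (subst_iter \<theta> k a) = map (\<lambda>_. r) (subst_iter \<theta> k a)"
    using subst_iter_letters[OF Suc.prems, of k] constant_length
    unfolding constant_length_def by auto
  have "sum_list (map (length \<circ> \<theta>) (subst_iter \<theta> k a)) = r * r ^ k"
    unfolding * using Suc by (simp add: sum_list_triv)
  then show ?case by (simp add: subst_iter_Suc length_concat)
qed (simp add: subst_iter_0)

lemma nth_subst_iter: "a \<le> s \<Longrightarrow> i < r ^ k \<Longrightarrow> subst_iter \<theta> k a ! i = W k a (int i)"
proof (induction k arbitrary: i)
  case (Suc k)
  have "concat (map \<theta> (subst_iter \<theta> k a)) ! i = \<theta> (subst_iter \<theta> k a ! (i div r)) ! (i mod r)"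
    using subst_iter_letters[OF Suc.prems(1), of k] constant_length Suc.prems length_subst_iter
    unfolding constant_length_def by (intro nth_concat_const) auto
  moreover have "i div r < r ^ k"
    using Suc.prems(2) by (simp add: less_mult_imp_div_less mult.commute)
  ultimately show ?case using Suc
    by (simp add: subst_iter_Suc flip: zdiv_int zmod_int)
qed (simp add: subst_iter_0)

text \<open>Aperiodicity includes the existence of a fixed point; its two-letter words lie in blocks
  of length r^k, which is impossible for r <= 1.\<close>

lemma r_gt_1: "r > 1"
proof -
  obtain x where "x \<in> X" using aperiodic by (auto simp: aperiodic_def fixed_points_def)
  then obtain k a where a: "a \<in> {0..s}" "sublist (subword x 0 2) (subst_iter \<theta> k a)"
    unfolding subst_space_def by blast
  have "2 \<le> r ^ k" using sublist_length_le[OF a(2)] a(1) by (simp add: subword_def length_subst_iter)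
  then have "\<not> r \<le> 1" using power_le_one[of r k] by fastforce
  then show ?thesis by simp
qed

lemma R_pos [simp]: "R k > 0" using r_gt_1 by (simp add: R_def)

lemma R_nonneg [simp]: "R k \<ge> 0" "R k \<noteq> 0" using R_pos[of k] by linarith+

lemma R_0 [simp]: "R 0 = 1" by (simp add: R_def)

lemma R_Suc [simp]: "R (Suc k) = int r * R k" by (simp add: R_def)

lemma R_1: "R 1 = int r" by (simp add: R_def)

lemma R_add: "R (k + j) = R k * R j" by (simp add: R_def power_add)

lemma R_gt: "int n < R n"
  using r_gt_1 by (simp add: R_def power_gt_expt del: of_nat_power)

lemma R_le_imp: "R j \<le> R k \<Longrightarrow> j \<le> k"
  unfolding R_def of_nat_le_iff using r_gt_1 by (metis power_le_imp_le_exp)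

lemma R_div [simp]: "0 \<le> i \<Longrightarrow> i < R k \<Longrightarrow> (R k * j + i) div R k = j"
  and R_mod [simp]: "0 \<le> i \<Longrightarrow> i < R k \<Longrightarrow> (R k * j + i) mod R k = i"
  by (auto intro: int_div_pos_eq int_mod_pos_eq)

lemma R_split: "i = R k * (i div R k) + i mod R k"
  and R_mod_ge [simp]: "0 \<le> i mod R k"
  and R_mod_lt [simp]: "i mod R k < R k"
  by auto

lemma nat_mod_lt: "nat (i mod int r) < r"
  using r_gt_1 by (simp add: nat_less_iff)

lemma W_letter: "a \<le> s \<Longrightarrow> W k a i \<le> s"
proof (induction k arbitrary: i)
  case (Suc k)
  then have "W k a (i div int r) \<in> {0..s}" by simp
  moreover from this have "\<theta> (W k a (i div int r)) ! nat (i mod int r) \<in> set (\<theta> (W k a (i div int r)))"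
    using constant_length nat_mod_lt unfolding constant_length_def by (intro nth_mem) auto
  ultimately show ?case using substitution unfolding substitution_def by fastforce
qed simp

text \<open>A column of \<theta>^k is a composition of k columns of \<theta>, each injective on
  letters by bijectivity.\<close>

lemma W_inj: "a \<le> s \<Longrightarrow> b \<le> s \<Longrightarrow> W k a i = W k b i \<Longrightarrow> a = b"
proof (induction k arbitrary: i)
  case (Suc k)
  have "W k a (i div int r) \<le> s" "W k b (i div int r) \<le> s" using Suc.prems W_letter by auto
  then have "W k a (i div int r) = W k b (i div int r)"
    using Suc.prems(3) bijective nat_mod_lt unfolding bijective_def by fastforce
  then show ?case using Suc by blast
qed simp

lemma W_first: "a \<le> s \<Longrightarrow> W k a 0 = a"
proof (induction k)
  case (Suc k)
  then show ?case using canonical unfolding canonical_form_def by simp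
qed simp

lemma W_last: "a \<le> s \<Longrightarrow> W k a (R k - 1) = a"
proof (induction k)
  case (Suc k)
  have "(int r * R k - 1) div int r = R k - 1" "(int r * R k - 1) mod int r = int r - 1"
    using r_gt_1 int_div_pos_eq[of "int r * R k - 1" "int r" "R k - 1" "int r - 1"]
      int_mod_pos_eq[of "int r * R k - 1" "int r" "R k - 1" "int r - 1"]
    by (simp_all add: algebra_simps)
  moreover have "nat (int r - 1) = r - 1" by simp
  ultimately show ?case using canonical Suc unfolding canonical_form_def by simp
qed simp

lemma W_add: "W (k + j) a i = W k (W j a (i div R k)) (i mod R k)"
proof (induction k arbitrary: i)
  case (Suc k)
  have 1: "i mod (int r * R k) div int r = i div int r mod R k"
    using r_gt_1 by (simp add: zmod_zmult2_eq)
  have 2: "i mod (int r * R k) mod int r = i mod int r" by (simp add: mod_mult_mult2 mod_mod_cancel)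
  have 3: "i div (int r * R k) = i div int r div R k" using r_gt_1 by (simp add: zdiv_zmult2_eq)
  show ?case using Suc by (simp add: 1 2 3)
qed simp

text \<open>The sublist condition in the form used by every limit argument: windows centred at the
  origin, each read off one block with an offset.\<close>

lemma mem_X_iff:
  "x \<in> X \<longleftrightarrow> (\<forall>L::nat. \<exists>k a o'. a \<le> s \<and>
     (\<forall>i. \<bar>i\<bar> \<le> int L \<longrightarrow> 0 \<le> o' + i \<and> o' + i < R k \<and> x i = W k a (o' + i)))"
  (is "_ \<longleftrightarrow> ?rhs")
proof
  assume x: "x \<in> X"
  show ?rhs
  proof
    fix L :: nat
    obtain k a where a: "a \<le> s" "sublist (subword x (- int L) (2 * L + 1)) (subst_iter \<theta> k a)"
      using x by (fastforce simp: subst_space_def)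
    then obtain p where p: "p + (2 * L + 1) \<le> r ^ k"
      "\<And>i. i < 2 * L + 1 \<Longrightarrow> x (int i - int L) = subst_iter \<theta> k a ! (p + i)"
      unfolding sublist_iff_nth by (auto simp: subword_def length_subst_iter simp del: upt_Suc)
    have "0 \<le> int (p + L) + i \<and> int (p + L) + i < R k \<and> x i = W k a (int (p + L) + i)"
      if i: "\<bar>i\<bar> \<le> int L" for i
    proof -
      define j where "j = nat (i + int L)"
      have j: "int j = i + int L" "j < 2 * L + 1" using i by (auto simp: j_def)
      have "p + j < r ^ k" using p(1) j(2) by simp
      moreover from this have "int (p + j) < R k" unfolding R_def by (rule iffD2[OF of_nat_less_iff])
      ultimately show ?thesis using p(2)[OF j(2)] nth_subst_iter[OF a(1)] j i
        by (simp add: algebra_simps)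
    qed
    then show "\<exists>k a o'. a \<le> s \<and>
     (\<forall>i. \<bar>i\<bar> \<le> int L \<longrightarrow> 0 \<le> o' + i \<and> o' + i < R k \<and> x i = W k a (o' + i))"
      using a(1) by blast
  qed
next
  assume R: ?rhs
  have "\<exists>k. \<exists>a\<in>{0..s}. sublist (subword x m l) (subst_iter \<theta> k a)" for m l
  proof -
    obtain k a q where a: "a \<le> s"
      and q: "\<And>i. \<bar>i\<bar> \<le> int (nat \<bar>m\<bar> + l) \<Longrightarrow> 0 \<le> q + i \<and> q + i < R k \<and> x i = W k a (q + i)"
      using R by meson
    have nn: "0 \<le> q + m" using q[of m] by simp
    have le: "nat (q + m) + l \<le> r ^ k"
    proof -
      have "q + (m + int l) - 1 < R k" using q[of "m + int l - 1"] q[of m]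
        by (cases "l = 0") (auto simp: algebra_simps)
      then have "int (nat (q + m) + l) \<le> int (r ^ k)" using nn by (simp add: R_def)
      then show ?thesis by (rule iffD1[OF of_nat_le_iff])
    qed
    have "x (m + int i) = subst_iter \<theta> k a ! (nat (q + m) + i)" if "i < l" for i
      using q[of "m + int i"] nth_subst_iter[OF a, of "nat (q + m) + i"] that le nn
      by (simp add: algebra_simps)
    then have "sublist (subword x m l) (subst_iter \<theta> k a)"
      unfolding sublist_iff_nth using le a
      by (intro exI[of _ "nat (q + m)"]) (simp add: subword_def length_subst_iter)
    then show ?thesis using a by (meson atLeastAtMost_iff le0)
  qed
  then show "x \<in> X" by (simp add: subst_space_def)
qed

lemma X_letter:
  assumes "x \<in> X"
  shows "x i \<le> s"
proof -
  obtain k a q where "a \<le> s" "\<And>j. \<bar>j\<bar> \<le> int (nat \<bar>i\<bar>) \<Longrightarrow> x j = W k a (q + j)"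
    using assms unfolding mem_X_iff by meson
  then show ?thesis using W_letter by simp
qed

lemma X_closed:
  assumes "\<And>L. \<exists>y\<in>X. agree L x y"
  shows "x \<in> X"
  unfolding mem_X_iff
proof
  fix L
  obtain y where y: "y \<in> X" "\<And>i. \<bar>i\<bar> \<le> int L \<Longrightarrow> x i = y i"
    using assms[of L] unfolding agree_def by blast
  then obtain k a q where "a \<le> s"
    "\<And>i. \<bar>i\<bar> \<le> int L \<Longrightarrow> 0 \<le> q + i \<and> q + i < R k \<and> y i = W k a (q + i)"
    unfolding mem_X_iff by meson
  with y(2) show "\<exists>k a o'. a \<le> s \<and>
     (\<forall>i. \<bar>i\<bar> \<le> int L \<longrightarrow> 0 \<le> o' + i \<and> o' + i < R k \<and> x i = W k a (o' + i))"
    by (intro exI[of _ k] exI[of _ a] exI[of _ q]) simp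
qed

lemma shift_in_X:
  assumes "x \<in> X"
  shows "shift_pow m x \<in> X"
  unfolding mem_X_iff
proof
  fix L :: nat
  obtain k a q where "a \<le> s"
    and q: "\<And>i. \<bar>i\<bar> \<le> int (L + nat \<bar>m\<bar>) \<Longrightarrow> 0 \<le> q + i \<and> q + i < R k \<and> x i = W k a (q + i)"
    using assms unfolding mem_X_iff by meson
  have "0 \<le> q + m + i \<and> q + m + i < R k \<and> shift_pow m x i = W k a (q + m + i)"
    if "\<bar>i\<bar> \<le> int L" for i
    using q[of "i + m"] that by (simp add: shift_pow_def algebra_simps)
  with \<open>a \<le> s\<close> show "\<exists>k a o'. a \<le> s \<and>
     (\<forall>i. \<bar>i\<bar> \<le> int L \<longrightarrow> 0 \<le> o' + i \<and> o' + i < R k \<and> shift_pow m x i = W k a (o' + i))" by blast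
qed

lemma shift_shift: "shift_pow m (shift_pow n x) = shift_pow (m + n) x"
  by (auto simp: shift_pow_def algebra_simps)

lemma shift_0 [simp]: "shift_pow 0 x = x" by (simp add: shift_pow_def)

section \<open>Desubstitution and recognizability\<close>

lemma inflate_eval: "0 \<le> i \<Longrightarrow> i < R k \<Longrightarrow> inflate k y (R k * j + i) = W k (y j) i"
  by (simp add: inflate_def)

lemma inflate_first: "y \<in> X \<Longrightarrow> inflate k y (R k * j) = y j"
  using inflate_eval[of 0 k y j] by (simp add: W_first X_letter)

lemma inflate_last: "y \<in> X \<Longrightarrow> inflate k y (R k * j - 1) = y (j - 1)"
  using inflate_eval[of "R k - 1" k y "j - 1"] R_pos[of k] by (simp add: W_last X_letter algebra_simps)

lemma inflate_0 [simp]: "inflate 0 y = y"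
  by (simp add: inflate_def)

lemma inflate_add: "inflate (k + j) y = inflate k (inflate j y)"
proof
  fix m
  have 1: "m mod (R k * R j) div R k = m div R k mod R j"
    using zmod_zmult2_eq[of "R j" m "R k"] R_div[of "m mod R k" k "m div R k mod R j"] by simp
  have 2: "m mod (R k * R j) mod R k = m mod R k" by (simp add: mod_mod_cancel)
  have 3: "m div (R k * R j) = m div R k div R j" by (simp add: zdiv_zmult2_eq)
  show "inflate (k + j) y m = inflate k (inflate j y) m"
    unfolding inflate_def by (simp add: R_add W_add 1 2 3)
qed

lemma inflate_shift: "inflate k (shift_pow e y) = shift_pow (R k * e) (inflate k y)"
  by (auto simp: inflate_def shift_pow_def fun_eq_iff add.commute)

lemma abs_div_R: "\<bar>i div R k\<bar> \<le> \<bar>i\<bar>"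
proof (cases "i \<ge> 0")
  case True
  then have nn: "0 \<le> i div R k" by (simp add: pos_imp_zdiv_nonneg_iff)
  then have "1 * (i div R k) \<le> R k * (i div R k)"
    using R_pos[of k] by (intro mult_right_mono) linarith+
  then have "i div R k \<le> i" using R_split[of i k] R_mod_ge[of i k] by linarith
  then show ?thesis using True nn by simp
next
  case False
  then have "i div R k < 0" by (simp add: pos_imp_zdiv_neg_iff)
  moreover have "i * R k \<le> i * 1"
    using False R_pos[of k] by (intro mult_left_mono_neg) linarith+
  then have "i * R k div R k \<le> i div R k" by (intro zdiv_mono1) auto
  then have "i \<le> i div R k" by simp
  ultimately show ?thesis using False by simp
qed

lemma inflate_in_X:
  assumes "y \<in> X"
  shows "inflate k y \<in> X"
  unfolding mem_X_iff
proof
  fix L :: nat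
  obtain j a q where a: "a \<le> s"
    and q: "\<And>i. \<bar>i\<bar> \<le> int L \<Longrightarrow> 0 \<le> q + i \<and> q + i < R j \<and> y i = W j a (q + i)"
    using assms unfolding mem_X_iff by meson
  have "0 \<le> R k * q + i \<and> R k * q + i < R (k + j) \<and> inflate k y i = W (k + j) a (R k * q + i)"
    if i: "\<bar>i\<bar> \<le> int L" for i
  proof -
    have d: "i = R k * (i div R k) + i mod R k" "0 \<le> i mod R k" "i mod R k < R k"
      using R_split[of i k] by auto
    have ab: "\<bar>i div R k\<bar> \<le> int L" using abs_div_R i by (meson order_trans)
    have Q: "0 \<le> q + i div R k" "q + i div R k \<le> R j - 1" "y (i div R k) = W j a (q + i div R k)"
      using q[OF ab] by auto
    have "R k * q + i = R k * (q + i div R k) + i mod R k" using d(1) by (simp add: algebra_simps)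
    moreover have *: "0 \<le> R k * (q + i div R k)" using Q(1) R_pos[of k] by simp
    moreover have "R k * (q + i div R k) \<le> R k * R j - R k"
      using mult_left_mono[OF Q(2), of "R k"] by (simp add: algebra_simps)
    moreover have "W (k + j) a (R k * q + i) = inflate k y i"
      unfolding W_add inflate_def Q(3) using R_pos[of k] by simp
    ultimately show ?thesis using d(2,3) unfolding R_add by linarith
  qed
  then show "\<exists>k' a o'. a \<le> s \<and>
     (\<forall>i. \<bar>i\<bar> \<le> int L \<longrightarrow> 0 \<le> o' + i \<and> o' + i < R k' \<and> inflate k y i = W k' a (o' + i))"
    using a by blast
qed

lemma boundaryI: "y \<in> X \<Longrightarrow> (\<And>m. x (t + m) = inflate k y m) \<Longrightarrow> boundary k x t"
  unfolding boundary_def by (intro bexI[of _ y]) (auto simp: shift_pow_def add.commute)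

lemma boundaryE:
  assumes "boundary k x t"
  obtains y where "y \<in> X" "\<And>m. x (t + m) = inflate k y m"
  using assms unfolding boundary_def by (auto simp: shift_pow_def fun_eq_iff add.commute)

lemma boundary_shift: "boundary k (shift_pow m x) t \<longleftrightarrow> boundary k x (t + m)"
  by (simp add: boundary_def shift_shift)

lemma boundary_period: "boundary k x t \<Longrightarrow> boundary k x (t + R k * e)"
  unfolding boundary_def
proof (elim bexE)
  fix y assume "y \<in> X" "shift_pow t x = inflate k y"
  then have "shift_pow (t + R k * e) x = inflate k (shift_pow e y)"
    using shift_shift[of "R k * e" t x] by (simp add: inflate_shift add.commute)
  then show "\<exists>y\<in>X. shift_pow (t + R k * e) x = inflate k y" using shift_in_X[OF \<open>y \<in> X\<close>] by blast
qed

lemma boundary_cong: "boundary k x t \<Longrightarrow> [t = t'] (mod R k) \<Longrightarrow> boundary k x t'"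
  by (auto simp: cong_iff_lin intro: boundary_period)

lemma boundary_anti:
  assumes "j \<le> k" "boundary k x t"
  shows "boundary j x t"
proof -
  obtain y where "y \<in> X" "shift_pow t x = inflate k y" using assms unfolding boundary_def by blast
  moreover have "inflate k y = inflate j (inflate (k - j) y)" using inflate_add[of j "k - j" y] assms(1) by simp
  ultimately show ?thesis unfolding boundary_def
    by (intro bexI[of _ "inflate (k - j) y"]) (simp_all add: inflate_in_X)
qed

text \<open>Since \<open>\<theta> a\<close> starts with \<open>a\<close>, a desubstitution of \<open>x\<close> can only be the decimation
  \<open>j \<mapsto> x (t + r ^ k * j)\<close>.\<close>

lemma boundary_exists:
  assumes "x \<in> X"
  shows "\<exists>t\<in>{0..<R k}. boundary k x t"
proof -
  \<comment> \<open>\<open>Q L t\<close> is desubstitution with phase \<open>t\<close> on one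
    window, the coarse word being read off \<theta>^j(a) from offset \<open>c\<close>. It gets
    stronger with \<open>L\<close>, and only finitely many phases compete.\<close>
  define Q where "Q = (\<lambda>(L::nat) t. \<exists>j a c. a \<le> s \<and> (\<forall>i. \<bar>i\<bar> \<le> int L \<longrightarrow>
     0 \<le> c + (i - t) div R k \<and> c + (i - t) div R k < R j \<and>
     x i = W k (W j a (c + (i - t) div R k)) ((i - t) mod R k)))"
  have ex: "\<exists>t\<in>{0..<R k}. Q L t" for L
  proof -
    \<comment> \<open>The margin \<open>r ^ k\<close> forces k <= K: the window has 2 L' + 1
      positions inside a block of length \<open>R K\<close>.\<close>
    define L' where "L' = L + r ^ k"
    obtain K a q where a: "a \<le> s"
      and q: "\<And>i. \<bar>i\<bar> \<le> int L' \<Longrightarrow> 0 \<le> q + i \<and> q + i < R K \<and> x i = W K a (q + i)"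
      using assms unfolding mem_X_iff by meson
    have "int L' = int L + R k" by (simp add: L'_def R_def)
    then have kK: "k \<le> K" using q[of "int L'"] q[of "- int L'"] by (intro R_le_imp) simp
    define j where "j = K - k"
    have K: "K = k + j" using kK by (simp add: j_def)
    \<comment> \<open>The level-k cuts of \<theta>^K(a) are at multiples of \<open>R k\<close>; in
      the coordinates of \<open>x\<close> these are the positions congruent to -q.\<close>
    define t where "t = (- q) mod R k"
    define c where "c = (q + t) div R k"
    have "R k dvd q + t" unfolding t_def by (simp add: dvd_eq_mod_eq_0 mod_add_right_eq)
    then have qc: "q = R k * c - t" by (simp add: c_def)
    have "0 \<le> c + (i - t) div R k \<and> c + (i - t) div R k < R j \<and>
     x i = W k (W j a (c + (i - t) div R k)) ((i - t) mod R k)" if i: "\<bar>i\<bar> \<le> int L" for i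
    proof -
      have qi: "q + i = (i - t) + c * R k" by (simp add: qc algebra_simps)
      have 1: "(q + i) div R k = c + (i - t) div R k" "(q + i) mod R k = (i - t) mod R k"
        unfolding qi using R_pos[of k] by auto
      have A: "0 \<le> q + i" "q + i < R k * R j" "x i = W (k + j) a (q + i)"
      proof -
        have "\<bar>i\<bar> \<le> int L'" using i unfolding L'_def by linarith
        from q[OF this] show "0 \<le> q + i" "q + i < R k * R j" "x i = W (k + j) a (q + i)"
          unfolding K R_add by auto
      qed
      have "0 \<le> (q + i) div R k" using A(1) R_pos[of k] by (simp add: pos_imp_zdiv_nonneg_iff)
      moreover have "(q + i) div R k < R j"
      proof -
        have "R k * ((q + i) div R k) < R k * R j"
          using A(2) R_split[of "q + i" k] R_mod_ge[of "q + i" k] by linarith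
        then show ?thesis by simp
      qed
      ultimately show ?thesis using A(3) unfolding W_add by (simp add: 1)
    qed
    then have "Q L t" unfolding Q_def using a by blast
    moreover have "t \<in> {0..<R k}" using R_pos[of k] by (simp add: t_def)
    ultimately show ?thesis by blast
  qed
  have anti: "Q j t" if "j \<le> k" "Q k t" for j k t
    using that(2) unfolding Q_def by (meson order_trans of_nat_mono that(1))
  obtain t where t: "t \<in> {0..<R k}" "\<And>L. Q L t"
    using finite_antitone_choice[of "{0..<R k}" Q] ex anti by blast
  define y where "y = (\<lambda>j. x (t + R k * j))"
  have "\<exists>j a o'. a \<le> s \<and>
     (\<forall>i. \<bar>i\<bar> \<le> int L \<longrightarrow> 0 \<le> o' + i \<and> o' + i < R j \<and> y i = W j a (o' + i))" for L
  proof -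
    define M where "M = nat (R k * (int L + 1))"
    obtain j a c where a: "a \<le> s" and c: "\<And>i. \<bar>i\<bar> \<le> int M \<Longrightarrow>
     0 \<le> c + (i - t) div R k \<and> c + (i - t) div R k < R j \<and>
     x i = W k (W j a (c + (i - t) div R k)) ((i - t) mod R k)"
      using t(2)[of M] unfolding Q_def by meson
    have "0 \<le> c + i \<and> c + i < R j \<and> y i = W j a (c + i)" if i: "\<bar>i\<bar> \<le> int L" for i
    proof -
      have "\<bar>R k * i\<bar> \<le> R k * int L" using i R_pos[of k] by (simp add: abs_mult)
      then have "\<bar>t + R k * i\<bar> \<le> int M" using t(1) R_pos[of k] by (auto simp: M_def algebra_simps)
      from c[OF this] show ?thesis using R_pos[of k] W_first[OF W_letter[OF a]]
        by (simp add: y_def)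
    qed
    then show ?thesis using a by blast
  qed
  then have "y \<in> X" unfolding mem_X_iff by blast
  moreover have "x (t + m) = inflate k y m" for m
  proof -
    define M where "M = nat (\<bar>t + m\<bar> + \<bar>t + R k * (m div R k)\<bar>)"
    obtain j a c where a: "a \<le> s" and c: "\<And>i. \<bar>i\<bar> \<le> int M \<Longrightarrow>
     x i = W k (W j a (c + (i - t) div R k)) ((i - t) mod R k)"
      using t(2)[of M] unfolding Q_def by meson
    have "x (t + m) = W k (W j a (c + m div R k)) (m mod R k)"
      using c[of "t + m"] by (simp add: M_def)
    moreover have "y (m div R k) = W j a (c + m div R k)"
      using c[of "t + R k * (m div R k)"] W_first[OF W_letter[OF a]] R_pos[of k]
      by (simp add: M_def y_def)
    ultimately show ?thesis by (simp add: inflate_def)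
  qed
  ultimately show ?thesis using t(1) boundaryI by blast
qed

lemma boundary_exists': "x \<in> X \<Longrightarrow> \<exists>t. boundary k x t"
  using boundary_exists by blast

section \<open>Minimality and non-determinism\<close>

lemma letter_in_block:
  obtains k where "k \<ge> 1" "\<And>a b. a \<le> s \<Longrightarrow> b \<le> s \<Longrightarrow> \<exists>i. 0 \<le> i \<and> i < R k \<and> W k a i = b"
proof -
  obtain k where k: "k \<ge> 1" "\<And>a b. a \<le> s \<Longrightarrow> b \<le> s \<Longrightarrow> b \<in> set (subst_iter \<theta> k a)"
    using primitive unfolding primitive_def by (metis atLeastAtMost_iff le0)
  have "\<exists>i. 0 \<le> i \<and> i < R k \<and> W k a i = b" if ab: "a \<le> s" "b \<le> s" for a b
  proof -
    obtain i where "i < r ^ k" "subst_iter \<theta> k a ! i = b"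
      using k(2)[OF ab] ab length_subst_iter by (auto simp: in_set_conv_nth)
    moreover from this(1) have "int i < R k" unfolding R_def by (rule iffD2[OF of_nat_less_iff])
    ultimately show ?thesis using nth_subst_iter[OF ab(1)] by (intro exI[of _ "int i"]) auto
  qed
  then show ?thesis using that k(1) by blast
qed

text \<open>The window of z lies in some \<theta>^K(a). By primitivity a occurs in \<theta>^k(b) for
  every letter b, so \<theta>^K(a) occurs in each block of level K + k of x.\<close>

lemma X_minimal:
  assumes x: "x \<in> X" and z: "z \<in> X"
  shows "\<exists>q. agree L z (shift_pow q x)"
proof -
  obtain K a p where a: "a \<le> s"
    and p: "\<And>i. \<bar>i\<bar> \<le> int L \<Longrightarrow> 0 \<le> p + i \<and> p + i < R K \<and> z i = W K a (p + i)"
    using z unfolding mem_X_iff by meson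
  obtain k where k: "\<And>a b. a \<le> s \<Longrightarrow> b \<le> s \<Longrightarrow> \<exists>i. 0 \<le> i \<and> i < R k \<and> W k a i = b"
    by (rule letter_in_block) blast
  obtain t where "boundary (K + k) x t" using boundary_exists'[OF x] by blast
  then obtain y where y: "y \<in> X" "\<And>m. x (t + m) = inflate (K + k) y m" by (rule boundaryE) blast
  obtain j where j: "0 \<le> j" "j < R k" "W k (y 0) j = a" using k[of "y 0" a] X_letter[OF y(1)] a by blast
  have "z i = x (t + R K * j + p + i)" if i: "\<bar>i\<bar> \<le> int L" for i
  proof -
    have pi: "0 \<le> p + i" "p + i < R K" "z i = W K a (p + i)" using p[OF i] by auto
    have m: "(R K * j + (p + i)) div R K = j" "(R K * j + (p + i)) mod R K = p + i" using pi by auto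
    have "R K * j \<le> R K * (R k - 1)" using j by (intro mult_left_mono) auto
    then have "R K * j + (p + i) < R (K + k)" using pi(2) by (simp add: R_add algebra_simps)
    moreover have "0 \<le> R K * j + (p + i)" using pi(1) j(1) by simp
    ultimately have "inflate (K + k) y (R K * j + (p + i)) = W (K + k) (y 0) (R K * j + (p + i))"
      using inflate_eval[of "R K * j + (p + i)" "K + k" y 0] by simp
    also have "\<dots> = z i" unfolding W_add m using j(3) pi(3) by simp
    finally show ?thesis using y(2)[of "R K * j + (p + i)"] by (simp add: add.assoc)
  qed
  then show ?thesis unfolding agree_def shift_pow_def
    by (intro exI[of _ "t + R K * j + p"]) (simp add: add.commute add.left_commute)
qed

text \<open>By minimality determinism would pass to a fixed point z. Pigeonhole then gives, on each
  right half-line, a period of at most s + 1; one period serves all half-lines, so z would be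
  periodic.\<close>

lemma not_deterministic:
  assumes x: "x \<in> X"
  shows "\<exists>i j. x i = x j \<and> x (i + 1) \<noteq> x (j + 1)"
proof (rule ccontr)
  assume "\<not> ?thesis"
  then have det: "\<And>i j. x i = x j \<Longrightarrow> x (i + 1) = x (j + 1)" by blast
  obtain z where z: "z \<in> F" using aperiodic by (auto simp: aperiodic_def)
  then have zX: "z \<in> X" by (simp add: fixed_points_def)
  have pair: "\<exists>q. z i = x q \<and> z (i + 1) = x (q + 1)" for i
  proof -
    obtain q where q: "agree (nat (\<bar>i\<bar> + 1)) z (shift_pow q x)" using X_minimal[OF x zX] by blast
    have "z i = x (i + q)" "z (i + 1) = x (i + q + 1)"
      using q unfolding agree_def shift_pow_def by (auto simp: algebra_simps)
    then show ?thesis by blast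
  qed
  have detz: "z (i + 1) = z (j + 1)" if "z i = z j" for i j using pair[of i] pair[of j] det that by metis
  have detn: "z (i + int n) = z (j + int n)" if "z i = z j" for i j n
    using that
  proof (induction n)
    case (Suc n)
    then show ?case using detz[of "i + int n" "j + int n"] by (simp add: algebra_simps)
  qed simp
  define Q where "Q = (\<lambda>(n::nat) p. \<forall>i \<ge> - int n. z (i + p) = z i)"
  have "\<exists>p\<in>{1..int s + 1}. Q n p" for n
  proof -
    \<comment> \<open>The s + 2 positions end at -n, so determinism carries the repetition to every
      position from -n on.\<close>
    have "\<not> inj_on (\<lambda>i. z (- int n - int s - 1 + int i)) {0..Suc s}"
    proof
      assume "inj_on (\<lambda>i. z (- int n - int s - 1 + int i)) {0..Suc s}"
      then have "card {0..Suc s} \<le> card {0..s}"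
        using X_letter[OF zX] by (intro card_inj_on_le) auto
      then show False by simp
    qed
    then obtain i j where ij: "i < j" "j \<le> Suc s"
      "z (- int n - int s - 1 + int i) = z (- int n - int s - 1 + int j)"
      unfolding inj_on_def by (metis atLeastAtMost_iff linorder_neqE_nat)
    have "z (m + (int j - int i)) = z m" if "m \<ge> - int n" for m
      using detn[OF ij(3), of "nat (m - (- int n - int s - 1 + int i))"] that ij(1,2)
      by (simp add: algebra_simps)
    then show ?thesis using ij(1,2) unfolding Q_def by (intro bexI[of _ "int j - int i"]) auto
  qed
  moreover have "Q j p" if "j \<le> k" "Q k p" for j k p using that unfolding Q_def by auto
  ultimately obtain p where p: "p \<in> {1..int s + 1}" "\<And>n. Q n p"
    using finite_antitone_choice[of "{1..int s + 1}" Q] by blast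
  have "z (i + p) = z i" for i using p(2)[of "nat \<bar>i\<bar>"] unfolding Q_def by auto
  then have "shift_periodic z" unfolding shift_periodic_def shift_pow_def using p(1)
    by (intro exI[of _ p]) auto
  then show False using aperiodic z by (auto simp: aperiodic_def)
qed

text \<open>Two desubstitutions with phases differing by \<open>0 < d < r ^ k\<close> give
  \<open>W k (y j) d = W k (y (j + 1)) (d - 1)\<close>, as \<open>\<theta> ^ k\<close> fixes the first and the last letter;
  by bijectivity \<open>y j\<close> would determine \<open>y (j + 1)\<close>.\<close>

lemma boundary_unique:
  assumes "boundary k x t" "boundary k x t'"
  shows "[t = t'] (mod R k)"
proof (rule ccontr)
  assume ne: "\<not> ?thesis"
  define d where "d = (t' - t) mod R k"
  have d: "0 < d" "d < R k"
  proof -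
    have "d \<noteq> 0" using ne unfolding d_def cong_iff_dvd_diff
      by (metis dvd_eq_mod_eq_0 dvd_diff_commute)
    then show "0 < d" using R_pos[of k] pos_mod_sign[of "R k" "t' - t"] unfolding d_def by linarith
  qed (use R_pos[of k] in \<open>simp add: d_def\<close>)
  have "[t' = t + d] (mod R k)" unfolding d_def cong_def by (simp add: mod_add_right_eq)
  then have "boundary k x (t + d)" using boundary_cong assms(2) by blast
  then obtain y' where y': "y' \<in> X" "\<And>m. x (t + d + m) = inflate k y' m" by (rule boundaryE) blast
  obtain y where y: "y \<in> X" "\<And>m. x (t + m) = inflate k y m" using assms(1) by (rule boundaryE) blast
  have eq: "inflate k y (d + m) = inflate k y' m" for m using y(2)[of "d + m"] y'(2)[of m] by (simp add: add.assoc)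
  have "W k (y j) d = W k (y (j + 1)) (d - 1)" for j
  proof -
    have "W k (y j) d = y' j"
      using eq[of "R k * j"] inflate_eval[of d k y j] d inflate_first[OF y'(1)] by (simp add: add.commute)
    moreover have "W k (y (j + 1)) (d - 1) = y' j"
      using eq[of "R k * (j + 1) - 1"] inflate_eval[of "d - 1" k y "j + 1"] d inflate_last[OF y'(1), of k "j + 1"]
      by (simp add: algebra_simps)
    ultimately show ?thesis by simp
  qed
  then have "y i = y j \<Longrightarrow> y (i + 1) = y (j + 1)" for i j
    using W_inj X_letter[OF y(1)] by metis
  then show False using not_deterministic[OF y(1)] by blast
qed

section \<open>Fixed points and fibres\<close>

lemma subst_bi_eq: "subst_bi r \<theta> x = inflate 1 x"
  by (auto simp: subst_bi_def inflate_def fun_eq_iff R_def)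

text \<open>With 0 a boundary of every level, the right half is the union of the nested words
  \<theta>^k(x 0); likewise the left half grows from x (-1).\<close>

lemma singular_pos:
  assumes "x \<in> X" "\<And>k. boundary k x 0" "0 \<le> m" "m < R k"
  shows "x m = W k (x 0) m"
proof -
  obtain y where y: "y \<in> X" "\<And>m. x (0 + m) = inflate k y m" using assms(2) by (rule boundaryE) blast
  then show ?thesis using inflate_first[OF y(1), of k 0] inflate_eval[of m k y 0] assms(3,4) by simp
qed

lemma singular_neg:
  assumes "x \<in> X" "\<And>k. boundary k x 0" "- R k \<le> m" "m < 0"
  shows "x m = W k (x (-1)) (m + R k)"
proof -
  obtain y where y: "y \<in> X" "\<And>m. x (0 + m) = inflate k y m" using assms(2) by (rule boundaryE) blast
  then show ?thesis using inflate_last[OF y(1), of k 0] inflate_eval[of "m + R k" k y "-1"] assms(3,4) by simp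
qed

lemma singular_eqI:
  assumes "x \<in> X" "\<And>k. boundary k x 0" "y \<in> X" "\<And>k. boundary k y 0" "x 0 = y 0" "x (-1) = y (-1)"
  shows "x = y"
proof
  fix m
  have "\<bar>m\<bar> < R (nat \<bar>m\<bar>)" using R_gt[of "nat \<bar>m\<bar>"] by simp
  then show "x m = y m"
    using singular_pos[OF assms(1,2), of m "nat \<bar>m\<bar>"] singular_pos[OF assms(3,4), of m "nat \<bar>m\<bar>"]
      singular_neg[OF assms(1,2), of "nat \<bar>m\<bar>" m] singular_neg[OF assms(3,4), of "nat \<bar>m\<bar>" m] assms(5,6)
    by (cases "m \<ge> 0") auto
qed

text \<open>For the converse, \<theta>(x) again has 0 as a boundary of every level, and canonical
  form keeps the two letters around the origin, which determine such a point.\<close>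

lemma F_iff: "x \<in> F \<longleftrightarrow> x \<in> X \<and> (\<forall>k. boundary k x 0)"
proof
  assume "x \<in> F"
  then have x: "x \<in> X" "inflate 1 x = x" by (auto simp: fixed_points_def subst_bi_eq)
  have "inflate k x = x" for k
  proof (induction k)
    case (Suc k)
    then show ?case using inflate_add[of 1 k x] x(2) by simp
  qed simp
  then show "x \<in> X \<and> (\<forall>k. boundary k x 0)" using x(1) by (auto intro: boundaryI)
next
  assume "x \<in> X \<and> (\<forall>k. boundary k x 0)"
  then have x: "x \<in> X" "\<And>k. boundary k x 0" by auto
  have "boundary k (inflate 1 x) 0" for k
  proof -
    obtain y where y: "y \<in> X" "shift_pow 0 x = inflate k y" using x(2) unfolding boundary_def by blast
    then have "inflate 1 x = inflate k (inflate 1 y)" using inflate_add[of 1 k y] inflate_add[of k 1 y] by simp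
    then show ?thesis using inflate_in_X[OF y(1)] by (intro boundaryI) auto
  qed
  moreover have "inflate 1 x 0 = x 0" "inflate 1 x (-1) = x (-1)"
    using inflate_first[OF x(1), of 1 0] inflate_last[OF x(1), of 1 0] by auto
  ultimately have "inflate 1 x = x" using x inflate_in_X by (intro singular_eqI) auto
  then show "x \<in> F" using x by (simp add: fixed_points_def subst_bi_eq)
qed

lemma F_X: "x \<in> F \<Longrightarrow> x \<in> X"
  by (simp add: F_iff)

lemma F_pos: "x \<in> F \<Longrightarrow> 0 \<le> m \<Longrightarrow> m < R k \<Longrightarrow> x m = W k (x 0) m"
  by (rule singular_pos) (auto simp: F_iff)

lemma F_neg: "x \<in> F \<Longrightarrow> - R k \<le> m \<Longrightarrow> m < 0 \<Longrightarrow> x m = W k (x (-1)) (m + R k)"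
  by (rule singular_neg) (auto simp: F_iff)

lemma F_eqI: "x \<in> F \<Longrightarrow> y \<in> F \<Longrightarrow> x 0 = y 0 \<Longrightarrow> x (-1) = y (-1) \<Longrightarrow> x = y"
  by (rule singular_eqI) (auto simp: F_iff)

lemma F_T: "x \<in> F \<Longrightarrow> inflate k x = x"
proof (induction k)
  case (Suc k)
  then show ?case using inflate_add[of 1 k x] by (simp add: fixed_points_def subst_bi_eq)
qed simp

text \<open>By canonical form \<theta>^d keeps the letters at 0 and -1, and \<theta>^j of these two
  fills the positions from \<open>- R j\<close> to \<open>R j - 1\<close>. Hence the words
  \<theta>^j(z) stabilise at every coordinate.\<close>

lemma inflate_stable:
  assumes z: "z \<in> X" and "- R j \<le> m" "m < R j"
  shows "inflate (j + d) z m = inflate j z m"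
proof -
  have "inflate d z (m div R j) = z (m div R j)"
  proof (cases "m \<ge> 0")
    case True
    then show ?thesis using inflate_first[OF z, of d 0] R_div[of m j 0] assms(3) by simp
  next
    case False
    then show ?thesis using inflate_last[OF z, of d 0] R_div[of "m + R j" j "-1"] assms(2) by simp
  qed
  then show ?thesis unfolding inflate_add by (simp add: inflate_def[of j])
qed

lemma F_exists:
  assumes z: "z \<in> X"
  shows "\<exists>w\<in>F. w 0 = z 0 \<and> w (-1) = z (-1)"
proof -
  \<comment> \<open>Coordinate m is stable from level |m| + 1 on, so \<open>w\<close> is the
    pointwise limit of the words \<theta>^j(z).\<close>
  define w where "w = (\<lambda>m. inflate (nat \<bar>m\<bar> + 1) z m)"
  have w: "w m = inflate J z m" if "nat \<bar>m\<bar> + 1 \<le> J" for m J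
    using inflate_stable[OF z, of "nat \<bar>m\<bar> + 1" m "J - (nat \<bar>m\<bar> + 1)"] that R_gt[of "nat \<bar>m\<bar> + 1"]
    by (simp add: w_def)
  have wX: "w \<in> X"
  proof (rule X_closed)
    fix L
    have "agree L w (inflate (L + 1) z)" unfolding agree_def using w by auto
    then show "\<exists>y\<in>X. agree L w y" using inflate_in_X[OF z] by blast
  qed
  moreover have "boundary k w 0" for k
  proof (rule boundaryI[OF wX])
    fix m
    define J where "J = nat \<bar>m\<bar> + 1"
    have "w m = inflate (k + J) z m" using w by (simp add: J_def)
    also have "\<dots> = W k (inflate J z (m div R k)) (m mod R k)" unfolding inflate_add by (simp add: inflate_def[of k])
    also have "inflate J z (m div R k) = w (m div R k)"
      using w[of "m div R k" J] abs_div_R[of m k] by (simp add: J_def nat_le_eq_zle)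
    finally show "w (0 + m) = inflate k w m" by (simp add: inflate_def)
  qed
  ultimately have "w \<in> F" by (simp add: F_iff)
  moreover have "w 0 = z 0" using inflate_first[OF z, of 1 0] by (simp add: w_def)
  moreover have "w (-1) = z (-1)" using inflate_last[OF z, of 2 0] by (simp add: w_def numeral_2_eq_2)
  ultimately show ?thesis by blast
qed

lemma F_letter:
  assumes "a \<le> s"
  shows "\<exists>x\<in>F. x 0 = a" and "\<exists>x\<in>F. x (-1) = a"
proof -
  obtain z where z: "z \<in> F" using aperiodic by (auto simp: aperiodic_def)
  obtain k where k: "\<And>a b. a \<le> s \<Longrightarrow> b \<le> s \<Longrightarrow> \<exists>i. 0 \<le> i \<and> i < R k \<and> W k a i = b"
    by (rule letter_in_block) blast
  obtain i where "z i = a" using k[of "z 0" a] assms F_pos[OF z] X_letter[OF F_X[OF z]] by blast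
  then show "\<exists>x\<in>F. x 0 = a" "\<exists>x\<in>F. x (-1) = a"
    using F_exists[OF shift_in_X[OF F_X[OF z]], of i] F_exists[OF shift_in_X[OF F_X[OF z]], of "i + 1"]
    by (auto simp: shift_pow_def)
qed

lemma finite_F: "finite F"
proof -
  have "inj_on (\<lambda>x. (x (-1), x 0)) F" by (auto simp: inj_on_def intro: F_eqI)
  moreover have "(\<lambda>x. (x (-1), x 0)) ` F \<subseteq> {0..s} \<times> {0..s}" using X_letter F_X by auto
  ultimately show ?thesis by (meson finite_SigmaI finite_atLeastAtMost inj_on_finite)
qed

section \<open>Fibres of the odometer map\<close>

definition same_fiber :: "(int \<Rightarrow> nat) \<Rightarrow> (int \<Rightarrow> nat) \<Rightarrow> bool" where
  "same_fiber x y \<longleftrightarrow> (\<forall>k t. boundary k x t \<longleftrightarrow> boundary k y t)"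

text \<open>One inclusion suffices, because the boundaries of a level form exactly one residue
  class.\<close>

lemma same_fiberI:
  assumes "x \<in> X" "\<And>k t. boundary k x t \<Longrightarrow> boundary k y t"
  shows "same_fiber x y"
  unfolding same_fiber_def
proof (intro allI iffI)
  fix k t assume y: "boundary k y t"
  obtain t' where t': "boundary k x t'" using boundary_exists'[OF assms(1)] by blast
  have "[t' = t] (mod R k)" using boundary_unique[OF assms(2)[OF t'] y] .
  then show "boundary k x t" using boundary_cong[OF t'] by blast
qed (use assms(2) in blast)

text \<open>Each block is \<theta>^k of a single letter, and by bijectivity any one column recovers
  that letter.\<close>

lemma block_agree:
  assumes D: "boundary k x t" "boundary k y t" and "t \<le> p" "p < t + R k" "t \<le> q" "q < t + R k" and eq: "x p = y p"
  shows "x q = y q"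
proof -
  obtain x' where x': "x' \<in> X" "\<And>m. x (t + m) = inflate k x' m" using D(1) by (rule boundaryE) blast
  obtain y' where y': "y' \<in> X" "\<And>m. y (t + m) = inflate k y' m" using D(2) by (rule boundaryE) blast
  have ev: "x m = W k (x' 0) (m - t)" "y m = W k (y' 0) (m - t)" if "t \<le> m" "m < t + R k" for m
    using x'(2)[of "m - t"] y'(2)[of "m - t"] that inflate_eval[of "m - t" k _ 0] by auto
  have "x' 0 = y' 0" using ev[OF assms(3,4)] eq W_inj X_letter[OF x'(1)] X_letter[OF y'(1)] by metis
  then show ?thesis using ev[OF assms(5,6)] by simp
qed

text \<open>If no block holds both \<open>lo\<close> and \<open>hi\<close>, the last boundary up to
  \<open>hi\<close> is beyond \<open>lo\<close> at each level. The interval is finite and boundaries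
  are nested, so one position serves all levels.\<close>

lemma common_boundary_exists:
  assumes x: "x \<in> X" and "lo < hi"
    and no: "\<And>k t. boundary k x t \<Longrightarrow> t \<le> lo \<Longrightarrow> \<not> hi < t + R k"
  shows "\<exists>e\<in>{lo<..hi}. \<forall>k. boundary k x e"
proof (rule finite_antitone_choice)
  fix k
  obtain t where t: "boundary k x t" using boundary_exists'[OF x] by blast
  define e where "e = hi - (hi - t) mod R k"
  have "boundary k x e"
  proof (rule boundary_cong[OF t])
    show "[t = e] (mod R k)" unfolding e_def cong_def by (simp add: mod_diff_right_eq)
  qed
  moreover from this have "lo < e" using no[of k e] by (fastforce simp: e_def)
  moreover have "e \<le> hi" by (simp add: e_def)
  ultimately show "\<exists>e\<in>{lo<..hi}. boundary k x e" by auto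
qed (auto intro: boundary_anti)

text \<open>Either 0 shares a block with each position on the \<epsilon> side, or some e is a
  boundary of every level, and the blocks starting or ending at e exhaust a half-line. The reference
  coordinate p depends on the fibre and the side only.\<close>

lemma fiber_dichotomy:
  assumes x: "x \<in> X" and \<epsilon>: "\<epsilon> = 1 \<or> \<epsilon> = -1"
  shows "\<exists>p::int. \<forall>y z m. same_fiber x y \<longrightarrow> same_fiber x z \<longrightarrow> 0 \<le> \<epsilon> * (m - p) \<longrightarrow>
    (y m = z m \<longleftrightarrow> y p = z p)"
proof -
  have "\<exists>p. \<forall>n. 0 \<le> \<epsilon> * (n - p) \<longrightarrow> (\<exists>k t. boundary k x t \<and> t \<le> p \<and> t \<le> n \<and> p < t + R k \<and> n < t + R k)"
  proof (cases "\<forall>n. 0 \<le> \<epsilon> * n \<longrightarrow> (\<exists>k t. boundary k x t \<and> t \<le> 0 \<and> t \<le> n \<and> 0 < t + R k \<and> n < t + R k)")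
    case True
    then show ?thesis by (intro exI[of _ 0]) simp
  next
    case False
    then obtain n where n: "0 \<le> \<epsilon> * n"
      "\<And>k t. boundary k x t \<Longrightarrow> \<not> (t \<le> 0 \<and> t \<le> n \<and> 0 < t + R k \<and> n < t + R k)" by blast
    obtain t where "t \<in> {0..<R 0}" "boundary 0 x t" using boundary_exists[OF x, of 0] by blast
    then have "n \<noteq> 0" using n(2)[of 0 t] by auto
    have "\<exists>e\<in>{min 0 n<..max 0 n}. \<forall>k. boundary k x e"
    proof (rule common_boundary_exists[OF x])
      fix k t assume "boundary k x t" "t \<le> min 0 n"
      then show "\<not> max 0 n < t + R k" using n(2)[of k t] by (auto simp: max_less_iff_conj)
    qed (use \<open>n \<noteq> 0\<close> in auto)
    then obtain e where e: "\<And>k. boundary k x e" by blast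
    show ?thesis
    proof (cases "\<epsilon> = 1")
      case True
      have "\<exists>k t. boundary k x t \<and> t \<le> e \<and> t \<le> n \<and> e < t + R k \<and> n < t + R k" if "0 \<le> \<epsilon> * (n - e)" for n
        using e that True R_gt[of "nat (n - e)"]
        by (intro exI[of _ "nat (n - e)"] exI[of _ e]) auto
      then show ?thesis by blast
    next
      \<comment> \<open>On the left the blocks end just before e, so the reference coordinate is e -
        1.\<close>
      case False
      have "\<exists>k t. boundary k x t \<and> t \<le> e - 1 \<and> t \<le> n \<and> e - 1 < t + R k \<and> n < t + R k"
        if "0 \<le> \<epsilon> * (n - (e - 1))" for n
      proof -
        have "boundary (nat (e - n)) x (e - R (nat (e - n)))"
          using boundary_period[OF e, where e = "-1"] by simp
        then show ?thesis using that False \<epsilon> R_gt[of "nat (e - n)"]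
          by (intro exI[of _ "nat (e - n)"] exI[of _ "e - R (nat (e - n))"]) auto
      qed
      then show ?thesis by blast
    qed
  qed
  then obtain p where p: "\<And>n. 0 \<le> \<epsilon> * (n - p) \<Longrightarrow>
    \<exists>k t. boundary k x t \<and> t \<le> p \<and> t \<le> n \<and> p < t + R k \<and> n < t + R k" by blast
  have "y m = z m \<longleftrightarrow> y p = z p"
    if sf: "same_fiber x y" "same_fiber x z" "0 \<le> \<epsilon> * (m - p)" for y z m
  proof -
    obtain k t where "boundary k x t" and t: "t \<le> p" "t \<le> m" "p < t + R k" "m < t + R k" using p[OF sf(3)] by blast
    then have "boundary k y t" "boundary k z t" using sf(1,2) unfolding same_fiber_def by auto
    then show ?thesis using block_agree[of k y t z p m] block_agree[of k y t z m p] t by blast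
  qed
  then show ?thesis by blast
qed

text \<open>The desubstituted word is a decimation of the point, so it converges along with the
  approximating points.\<close>

lemma boundary_closed:
  assumes "\<And>L. \<exists>y'\<in>X. agree L y y' \<and> boundary k y' t"
  shows "boundary k y t"
proof -
  define w where "w = (\<lambda>j. y (t + R k * j))"
  have "w \<in> X"
  proof (rule X_closed)
    fix L :: nat
    define M where "M = nat (\<bar>t\<bar> + R k * int L)"
    obtain y' where y': "agree M y y'" "boundary k y' t" using assms[of M] by blast
    obtain w' where w': "w' \<in> X" "\<And>m. y' (t + m) = inflate k w' m" using y'(2) by (rule boundaryE) blast
    have "w i = w' i" if i: "\<bar>i\<bar> \<le> int L" for i
    proof -
      have "\<bar>R k * i\<bar> \<le> R k * int L" using i by (simp add: abs_mult)
      then have "\<bar>t + R k * i\<bar> \<le> int M" unfolding M_def by linarith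
      then have "y (t + R k * i) = y' (t + R k * i)" using y'(1) unfolding agree_def by blast
      then show ?thesis using w'(2)[of "R k * i"] inflate_first[OF w'(1)] by (simp add: w_def)
    qed
    then show "\<exists>y\<in>X. agree L w y" using w'(1) unfolding agree_def by blast
  qed
  moreover have "y (t + m) = inflate k w m" for m
  proof -
    define M where "M = nat (\<bar>t + m\<bar> + \<bar>t + R k * (m div R k)\<bar>)"
    obtain y' where y': "agree M y y'" "boundary k y' t" using assms[of M] by blast
    obtain w' where w': "w' \<in> X" "\<And>m. y' (t + m) = inflate k w' m" using y'(2) by (rule boundaryE) blast
    have "y (t + m) = y' (t + m)" "w (m div R k) = y' (t + R k * (m div R k))"
      using y'(1) unfolding agree_def M_def w_def by auto
    then show ?thesis using w'(2)[of "R k * (m div R k)"] w'(2)[of m] inflate_first[OF w'(1)] by (simp add: inflate_def)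
  qed
  ultimately show ?thesis by (rule boundaryI)
qed

text \<open>Continuity of the odometer map at level k: wrong residues are finitely many, and one
  realised in every window would survive in the limit.\<close>

lemma fiber_window:
  assumes y: "y \<in> X"
  shows "\<exists>L. \<forall>y'\<in>X. agree L y y' \<longrightarrow> (\<forall>t. boundary k y' t \<longleftrightarrow> boundary k y t)"
proof -
  define P where "P = (\<lambda>L t. \<exists>y'\<in>X. agree L y y' \<and> boundary k y' t)"
  define B where "B = {t \<in> {0..<R k}. \<not> boundary k y t}"
  have "\<exists>L. \<forall>t\<in>B. \<not> P L t"
  proof (rule ccontr)
    assume "\<not> ?thesis"
    then have "\<And>L. \<exists>t\<in>B. P L t" by blast
    moreover have "P j t" if jl: "j \<le> l" "P l t" for j l t
      using jl unfolding P_def agree_def by (meson order_trans of_nat_mono)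
    moreover have "finite B" unfolding B_def by (rule finite_subset[of _ "{0..<R k}"]) auto
    ultimately have "\<exists>t\<in>B. \<forall>L. P L t" by (intro finite_antitone_choice) auto
    then obtain t where "t \<in> B" "\<And>L. P L t" by blast
    then show False using boundary_closed unfolding P_def B_def by blast
  qed
  then obtain L where L: "\<And>t. t \<in> {0..<R k} \<Longrightarrow> P L t \<Longrightarrow> boundary k y t" unfolding B_def by blast
  have "boundary k y' t' \<longleftrightarrow> boundary k y t'" if y': "y' \<in> X" "agree L y y'" for y' t'
  proof -
    obtain t where t: "t \<in> {0..<R k}" "boundary k y' t" using boundary_exists[OF y'(1)] by blast
    then have "boundary k y t" using L y' unfolding P_def by blast
    then show ?thesis using t(2) by (meson boundary_unique boundary_cong)
  qed
  then show ?thesis by blast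
qed

section \<open>Limits of shifts\<close>

lemma window_of_open:
  fixes y :: "int \<Rightarrow> nat"
  assumes "open U" "y \<in> U"
  shows "\<exists>L. \<forall>y'. agree L y y' \<longrightarrow> y' \<in> U"
proof -
  have "openin (product_topology (\<lambda>i. euclidean) UNIV) U" using assms(1) by (simp add: open_fun_def)
  from product_topology_open_contains_basis[OF this assms(2)]
  obtain V where V: "y \<in> Pi\<^sub>E UNIV V" "finite {i. V i \<noteq> (UNIV :: nat set)}" "Pi\<^sub>E UNIV V \<subseteq> U" by auto
  define L where "L = (\<Sum>i\<in>{i. V i \<noteq> UNIV}. nat \<bar>i\<bar>)"
  have "y' \<in> U" if ag: "agree L y y'" for y'
  proof -
    have "y' i \<in> V i" for i
    proof (cases "V i = UNIV")
      case False
      then have "nat \<bar>i\<bar> \<le> L" unfolding L_def using V(2) by (intro member_le_sum) auto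
      then have "\<bar>i\<bar> \<le> int L" by linarith
      then have "y' i = y i" using ag unfolding agree_def by simp
      then show ?thesis using V(1) by (auto simp: PiE_iff)
    qed simp
    then show ?thesis using V(3) by (auto simp: PiE_iff)
  qed
  then show ?thesis by blast
qed

lemma open_window: "open {y'. agree L y y'}"
proof -
  have "open ((\<lambda>y'. y' i) -` {y i})" for i
    by (intro open_vimage continuous_on_product_coordinates open_discrete)
  then have "open (\<Inter>i\<in>{- int L..int L}. (\<lambda>y'. y' i) -` {y i})" by (intro open_INT) auto
  moreover have "{y'. agree L y y'} = (\<Inter>i\<in>{- int L..int L}. (\<lambda>y'. y' i) -` {y i})"
    unfolding agree_def by (auto simp: abs_le_iff)
  ultimately show ?thesis by simp
qed

lemma agree_refl [simp]: "agree L x x"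
  and agree_trans: "agree L x y \<Longrightarrow> agree L y z \<Longrightarrow> agree L x z"
  and agree_mono: "L \<le> M \<Longrightarrow> agree M x y \<Longrightarrow> agree L x y"
  unfolding agree_def by auto

lemma compact_X: "compact X"
proof -
  have "compactin (product_topology (\<lambda>i. euclidean) UNIV) (Pi\<^sub>E UNIV (\<lambda>i::int. {0..s}))"
    unfolding compactin_PiE by (simp add: finite_imp_compact)
  then have "compact (Pi\<^sub>E UNIV (\<lambda>i::int. {0..s}))" by (simp add: euclidean_product_topology)
  moreover have "closed X"
    unfolding closed_def open_subopen[of "- X"]
  proof
    fix x assume "x \<in> - X"
    then obtain L where "\<And>y. y \<in> X \<Longrightarrow> \<not> agree L x y" using X_closed by blast
    then show "\<exists>U. open U \<and> x \<in> U \<and> U \<subseteq> - X"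
      by (intro exI[of _ "{y. agree L x y}"]) (auto simp: open_window)
  qed
  moreover have "X = Pi\<^sub>E UNIV (\<lambda>i::int. {0..s}) \<inter> X" using X_letter by auto
  ultimately show ?thesis by (metis compact_Int_closed)
qed

text \<open>The closure of the shifts by elements of S in X^X, written without nets: a basic
  neighbourhood tests finitely many points on one window.\<close>

definition shift_limits :: "int set \<Rightarrow> ((int \<Rightarrow> nat) \<Rightarrow> (int \<Rightarrow> nat)) set" where
  "shift_limits S = {f \<in> X \<rightarrow>\<^sub>E X. \<forall>Q L. finite Q \<longrightarrow> Q \<subseteq> X \<longrightarrow>
     (\<exists>m\<in>S. \<forall>x\<in>Q. agree L (f x) (shift_pow m x))}"

lemma shift_limitsD:
  "f \<in> shift_limits S \<Longrightarrow> finite Q \<Longrightarrow> Q \<subseteq> X \<Longrightarrow> \<exists>m\<in>S. \<forall>x\<in>Q. agree L (f x) (shift_pow m x)"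
  by (simp add: shift_limits_def)

lemma shift_limits_funcset: "f \<in> shift_limits S \<Longrightarrow> f \<in> X \<rightarrow>\<^sub>E X"
  by (simp add: shift_limits_def)

abbreviation "shift_topology \<equiv> product_topology (\<lambda>_. top_of_set X) X"

lemma closure_of_shifts:
  "shift_topology closure_of {restrict (shift_pow m) X | m. m \<in> S} = shift_limits S"
proof (intro equalityI subsetI)
  fix f assume f: "f \<in> shift_topology closure_of {restrict (shift_pow m) X | m. m \<in> S}"
  have fX: "f \<in> X \<rightarrow>\<^sub>E X" using f unfolding in_closure_of by simp
  moreover have "\<exists>m\<in>S. \<forall>x\<in>Q. agree L (f x) (shift_pow m x)" if Q: "finite Q" "Q \<subseteq> X" for Q L
  proof -
    define U where "U = {g \<in> X \<rightarrow>\<^sub>E X. \<forall>x\<in>Q. agree L (f x) (g x)}"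
    have "openin shift_topology U"
      unfolding U_def using Q
    proof (induction Q rule: finite_induct)
      case empty
      then show ?case using openin_topspace[of shift_topology] by simp
    next
      case (insert x Q)
      have "continuous_map shift_topology (top_of_set X) (\<lambda>g. g x)"
        using insert.prems by (intro continuous_map_product_projection) auto
      moreover have "openin (top_of_set X) (X \<inter> {y. agree L (f x) y})"
        using open_window by (intro openin_open_Int)
      ultimately have "openin shift_topology {g \<in> topspace shift_topology. g x \<in> X \<inter> {y. agree L (f x) y}}"
        by (rule openin_continuous_map_preimage)
      moreover have "{g \<in> X \<rightarrow>\<^sub>E X. \<forall>x\<in>insert x Q. agree L (f x) (g x)} =
        {g \<in> topspace shift_topology. g x \<in> X \<inter> {y. agree L (f x) y}} \<inter>
        {g \<in> X \<rightarrow>\<^sub>E X. \<forall>x\<in>Q. agree L (f x) (g x)}"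
        using insert.prems by auto
      ultimately show ?case using insert by (simp add: openin_Int)
    qed
    moreover have "f \<in> U" using fX Q unfolding U_def by auto
    ultimately obtain m where "m \<in> S" "restrict (shift_pow m) X \<in> U" using f unfolding in_closure_of by blast
    moreover have "agree L (f x) (shift_pow m x)" if "x \<in> Q" for x
      using that Q(2) calculation(2) unfolding U_def by (auto simp: subset_iff)
    ultimately show ?thesis by blast
  qed
  ultimately show "f \<in> shift_limits S" unfolding shift_limits_def by simp
next
  fix f assume f: "f \<in> shift_limits S"
  then have fX: "f \<in> X \<rightarrow>\<^sub>E X" by (rule shift_limits_funcset)
  have "\<exists>m\<in>S. restrict (shift_pow m) X \<in> U" if U: "f \<in> U" "openin shift_topology U" for U
  proof -
    obtain V where V: "f \<in> Pi\<^sub>E X V" "\<And>x. openin (top_of_set X) (V x)" "finite {x. V x \<noteq> X}" "Pi\<^sub>E X V \<subseteq> U"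
      using product_topology_open_contains_basis[OF U(2,1)] by auto
    define Q where "Q = {x\<in>X. V x \<noteq> X}"
    have "\<exists>L. \<forall>y'\<in>X. agree L (f x) y' \<longrightarrow> y' \<in> V x" if x: "x \<in> X" for x
    proof -
      obtain O' where O': "open O'" "V x = X \<inter> O'" using V(2)[of x] unfolding openin_open by blast
      moreover have "f x \<in> V x" using V(1) x by (simp add: PiE_iff)
      ultimately show ?thesis using window_of_open[of O' "f x"] by blast
    qed
    then obtain \<Lambda> where \<Lambda>: "\<And>x y'. x \<in> X \<Longrightarrow> y' \<in> X \<Longrightarrow> agree (\<Lambda> x) (f x) y' \<Longrightarrow> y' \<in> V x" by metis
    have Q: "finite Q" "Q \<subseteq> X" using V(3) by (auto simp: Q_def)
    then obtain m where m: "m \<in> S" "\<And>x. x \<in> Q \<Longrightarrow> agree (sum \<Lambda> Q) (f x) (shift_pow m x)"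
      using shift_limitsD[OF f Q, of "sum \<Lambda> Q"] by blast
    have "shift_pow m x \<in> V x" if x: "x \<in> X" for x
    proof (cases "x \<in> Q")
      case True
      then have "\<Lambda> x \<le> sum \<Lambda> Q" using Q by (intro member_le_sum) auto
      then show ?thesis using \<Lambda>[OF x shift_in_X[OF x]] m(2)[OF True] agree_mono by blast
    next
      case False
      then show ?thesis using x shift_in_X by (simp add: Q_def)
    qed
    then have "restrict (shift_pow m) X \<in> Pi\<^sub>E X V" by auto
    then show ?thesis using m(1) V(4) by blast
  qed
  then show "f \<in> shift_topology closure_of {restrict (shift_pow m) X | m. m \<in> S}"
    unfolding in_closure_of using fX by (simp add: Bex_def) blast
qed

lemma ellis_semigroup_eq: "ellis_semigroup X shift_pow = shift_limits UNIV"
  unfolding ellis_semigroup_def using closure_of_shifts[of UNIV] by simp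

text \<open>Compactness of X^X applied to the nested closures of tails. It replaces a convergent
  subsequence: f inherits whatever closed condition holds eventually along \<mu>.\<close>

lemma cluster_point:
  fixes \<mu> :: "nat \<Rightarrow> int"
  shows "\<exists>f. \<forall>n. f \<in> shift_limits (\<mu> ` {n..})"
proof -
  have "compact_space shift_topology"
    unfolding compact_space_product_topology using compact_X
    by (simp add: compact_space_subtopology)
  moreover have "shift_limits (\<mu> ` {n..}) \<noteq> {}" for n
  proof -
    have "restrict (shift_pow (\<mu> n)) X \<in> shift_topology closure_of {restrict (shift_pow m) X | m. m \<in> \<mu> ` {n..}}"
      by (rule subsetD[OF closure_of_subset]) (auto intro: shift_in_X)
    then show ?thesis unfolding closure_of_shifts by blast
  qed
  moreover have "closedin shift_topology (shift_limits (\<mu> ` {n..}))" for n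
    unfolding closure_of_shifts[symmetric] by simp
  moreover have "decseq (\<lambda>n. shift_limits (\<mu> ` {n..}))"
    unfolding closure_of_shifts[symmetric] decseq_def by (intro allI impI closure_of_mono) force
  ultimately have "(\<Inter>n. shift_limits (\<mu> ` {n..})) \<noteq> {}" by (intro compact_space_imp_nest)
  then show ?thesis by blast
qed

section \<open>Minimal left ideals\<close>

abbreviation "E \<equiv> shift_limits UNIV"

text \<open>Only the signs \<open>\<epsilon> = 1\<close> and \<open>\<epsilon> = -1\<close> matter: the limits of \<open>\<sigma>\<^sup>m\<close> as \<open>m\<close> tends to \<open>\<epsilon> * \<infinity>\<close>.\<close>

definition half :: "int \<Rightarrow> ((int \<Rightarrow> nat) \<Rightarrow> (int \<Rightarrow> nat)) set" where
  "half \<epsilon> = {f. \<forall>n. f \<in> shift_limits {m. n \<le> \<epsilon> * m}}"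

lemma shift_limits_mono: "S \<subseteq> S' \<Longrightarrow> shift_limits S \<subseteq> shift_limits S'"
  by (fastforce simp: shift_limits_def)

lemma shift_limits_in_X: "f \<in> shift_limits S \<Longrightarrow> x \<in> X \<Longrightarrow> f x \<in> X"
  using shift_limits_funcset by blast

lemma half_subset_E: "half \<epsilon> \<subseteq> E"
  using shift_limits_mono[of _ UNIV] by (auto simp: half_def)

lemma shift_limits_E: "f \<in> shift_limits S \<Longrightarrow> f \<in> E"
  using shift_limits_mono[of S UNIV] by blast

lemma half_limits: "f \<in> half \<epsilon> \<Longrightarrow> f \<in> shift_limits {m. n \<le> \<epsilon> * m}"
  by (simp add: half_def)

lemma agree_shift:
  assumes "agree (L + nat \<bar>m\<bar>) x y"
  shows "agree L (shift_pow m x) (shift_pow m y)"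
  using assms unfolding agree_def shift_pow_def by auto

lemma shift_limitsI:
  "f \<in> X \<rightarrow>\<^sub>E X \<Longrightarrow> (\<And>Q L. finite Q \<Longrightarrow> Q \<subseteq> X \<Longrightarrow> \<exists>m\<in>S. \<forall>x\<in>Q. agree L (f x) (shift_pow m x))
    \<Longrightarrow> f \<in> shift_limits S"
  by (simp add: shift_limits_def)

text \<open>The shift m for f is chosen first, on the g-images of Q; then g is approximated on a
  window enlarged by |m|. This order is why \<open>S'\<close> may depend on m: in
  \<open>compose_half\<close> the shifts for g must outrun that m.\<close>

lemma compose_shift_limits:
  assumes f: "f \<in> shift_limits S" and g: "\<And>m. m \<in> S \<Longrightarrow> g \<in> shift_limits (S' m)"
    and S'': "\<And>m m'. m \<in> S \<Longrightarrow> m' \<in> S' m \<Longrightarrow> m + m' \<in> S''" and gE: "g \<in> E"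
  shows "compose X f g \<in> shift_limits S''"
proof -
  have "\<exists>m\<in>S''. \<forall>x\<in>Q. agree L (compose X f g x) (shift_pow m x)" if Q: "finite Q" "Q \<subseteq> X" for Q L
  proof -
    have "finite (g ` Q)" "g ` Q \<subseteq> X" using Q shift_limits_in_X[OF gE] by auto
    then obtain m where m: "m \<in> S" "\<forall>x\<in>g ` Q. agree L (f x) (shift_pow m x)"
      using shift_limitsD[OF f] by meson
    obtain m' where m': "m' \<in> S' m" "\<forall>x\<in>Q. agree (L + nat \<bar>m\<bar>) (g x) (shift_pow m' x)"
      using shift_limitsD[OF g[OF m(1)] Q] by meson
    have "agree L (compose X f g x) (shift_pow (m + m') x)" if x: "x \<in> Q" for x
    proof -
      have "agree L (f (g x)) (shift_pow m (g x))" using m(2) x by blast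
      moreover have "agree L (shift_pow m (g x)) (shift_pow m (shift_pow m' x))"
        using m'(2) x agree_shift by blast
      ultimately have "agree L (f (g x)) (shift_pow (m + m') x)"
        unfolding shift_shift by (rule agree_trans)
      then show ?thesis using x Q(2) by (simp add: compose_eq subset_iff)
    qed
    then show ?thesis using S''[OF m(1) m'(1)] by blast
  qed
  moreover have "compose X f g \<in> X \<rightarrow>\<^sub>E X"
    using shift_limits_in_X[OF gE] shift_limits_in_X[OF f] by (auto simp: compose_def)
  ultimately show ?thesis by (intro shift_limitsI)
qed

lemma compose_half:
  assumes "f \<in> E" "g \<in> half \<epsilon>"
  shows "compose X f g \<in> half \<epsilon>"
  unfolding half_def
proof (intro CollectI allI)
  fix n
  show "compose X f g \<in> shift_limits {m. n \<le> \<epsilon> * m}"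
  proof (rule compose_shift_limits[OF assms(1), where S' = "\<lambda>m. {m'. n - \<epsilon> * m \<le> \<epsilon> * m'}"])
    show "g \<in> shift_limits {m'. n - \<epsilon> * m \<le> \<epsilon> * m'}" for m by (rule half_limits[OF assms(2)])
    show "g \<in> E" using assms(2) half_subset_E by blast
  qed (simp add: algebra_simps)
qed

lemma half_nonempty:
  assumes "\<epsilon> * \<epsilon> = 1"
  shows "half \<epsilon> \<noteq> {}"
proof -
  obtain f where f: "\<And>n. f \<in> shift_limits ((\<lambda>k. \<epsilon> * int k) ` {n..})" using cluster_point by blast
  have "f \<in> shift_limits {m. n \<le> \<epsilon> * m}" for n
  proof (rule subsetD[OF shift_limits_mono f[of "nat n"]])
    have "\<epsilon> * (\<epsilon> * int k) = int k" for k using assms by (metis mult.assoc mult_1)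
    then have "n \<le> \<epsilon> * (\<epsilon> * int k)" if "nat n \<le> k" for k using that by (metis nat_le_iff)
    then show "(\<lambda>k. \<epsilon> * int k) ` {nat n..} \<subseteq> {m. n \<le> \<epsilon> * m}" by blast
  qed
  then show ?thesis unfolding half_def by blast
qed

lemma shift_limits_Un:
  assumes "f \<in> shift_limits (S \<union> S')"
  shows "f \<in> shift_limits S \<or> f \<in> shift_limits S'"
proof (rule ccontr)
  assume "\<not> ?thesis"
  then have no: "f \<notin> shift_limits S" "f \<notin> shift_limits S'" by auto
  have "\<exists>Q L. finite Q \<and> Q \<subseteq> X \<and> (\<forall>m\<in>S. \<not> (\<forall>x\<in>Q. agree L (f x) (shift_pow m x)))"
    if "f \<notin> shift_limits S" for S
    using that shift_limitsI[OF shift_limits_funcset[OF assms], of S] by blast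
  from this[OF no(1)] this[OF no(2)] obtain Q L Q' L'
    where Q: "finite Q" "Q \<subseteq> X" "\<forall>m\<in>S. \<not> (\<forall>x\<in>Q. agree L (f x) (shift_pow m x))"
    and Q': "finite Q'" "Q' \<subseteq> X" "\<forall>m\<in>S'. \<not> (\<forall>x\<in>Q'. agree L' (f x) (shift_pow m x))"
    by blast
  obtain m where m: "m \<in> S \<union> S'" "\<forall>x\<in>Q \<union> Q'. agree (L + L') (f x) (shift_pow m x)"
    using shift_limitsD[OF assms, of "Q \<union> Q'" "L + L'"] Q(1,2) Q'(1,2) by auto
  then have "\<forall>x\<in>Q. agree L (f x) (shift_pow m x)" "\<forall>x\<in>Q'. agree L' (f x) (shift_pow m x)"
    using agree_mono[of L "L + L'"] agree_mono[of L' "L + L'"] by auto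
  then show False using m(1) Q(3) Q'(3) by blast
qed

section \<open>Action on the odometer\<close>

lemma shift_limits_residue:
  assumes f: "f \<in> shift_limits S" and c: "\<And>m. m \<in> S \<Longrightarrow> [m = c] (mod R k)" and x: "x \<in> X" and D: "boundary k x t"
  shows "boundary k (f x) (t - c)"
proof -
  obtain L where L: "\<And>y'. y' \<in> X \<Longrightarrow> agree L (f x) y' \<Longrightarrow> (\<forall>t. boundary k y' t \<longleftrightarrow> boundary k (f x) t)"
    using fiber_window[OF shift_limits_in_X[OF f x]] by blast
  obtain m where m: "m \<in> S" "agree L (f x) (shift_pow m x)" using shift_limitsD[OF f, of "{x}"] x by auto
  have "boundary k (shift_pow m x) (t - m)" using D by (simp add: boundary_shift)
  then have "boundary k (f x) (t - m)" using L[OF shift_in_X[OF x] m(2)] by blast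
  moreover have "[t - m = t - c] (mod R k)" using c[OF m(1)] by (intro cong_diff cong_refl)
  ultimately show ?thesis using boundary_cong by blast
qed

text \<open>Approximating f at a reference point and at x by one common shift carries the
  displacement seen at the former over to x. So an element of E acts on the odometer as a
  rotation.\<close>

lemma residue_exists:
  assumes f: "f \<in> E"
  shows "\<exists>c. \<forall>x\<in>X. \<forall>t. boundary k x t \<longrightarrow> boundary k (f x) (t - c)"
proof -
  obtain x0 where x0: "x0 \<in> X" using aperiodic F_X by (auto simp: aperiodic_def)
  have fX: "f x \<in> X" if "x \<in> X" for x using shift_limits_in_X[OF f that] .
  obtain t0 t1 where t0: "boundary k x0 t0" and t1: "boundary k (f x0) t1" using boundary_exists' x0 fX by meson
  have win: "\<exists>L. \<forall>m. agree L (f x) (shift_pow m x) \<longrightarrow> (\<forall>t. boundary k x t \<longrightarrow> boundary k (f x) (t - m))" if x: "x \<in> X" for x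
  proof -
    obtain L where L: "\<And>y'. y' \<in> X \<Longrightarrow> agree L (f x) y' \<Longrightarrow> (\<forall>t. boundary k y' t \<longleftrightarrow> boundary k (f x) t)"
      using fiber_window[OF fX[OF x]] by blast
    have "boundary k (f x) (t - m)" if "agree L (f x) (shift_pow m x)" "boundary k x t" for m t
    proof -
      have "boundary k (shift_pow m x) (t - m)" using that(2) by (simp add: boundary_shift)
      then show ?thesis using L[OF shift_in_X[OF x] that(1)] by blast
    qed
    then show ?thesis by blast
  qed
  obtain L0 where L0: "\<And>m t. agree L0 (f x0) (shift_pow m x0) \<Longrightarrow> boundary k x0 t \<Longrightarrow> boundary k (f x0) (t - m)"
    using win[OF x0] by blast
  have "boundary k (f x) (t - (t0 - t1))" if x: "x \<in> X" and t: "boundary k x t" for x t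
  proof -
    obtain L where L: "\<And>m t. agree L (f x) (shift_pow m x) \<Longrightarrow> boundary k x t \<Longrightarrow> boundary k (f x) (t - m)"
      using win[OF x] by blast
    obtain m where m: "agree (L0 + L) (f x0) (shift_pow m x0)" "agree (L0 + L) (f x) (shift_pow m x)"
      using shift_limitsD[OF f, of "{x0, x}"] x x0 by auto
    have "boundary k (f x0) (t0 - m)" using L0[OF agree_mono[OF _ m(1)] t0] by simp
    then have "[t0 - m = t1] (mod R k)" using boundary_unique t1 by blast
    then have "[t - m = t - (t0 - t1)] (mod R k)" by (simp add: cong_iff_dvd_diff algebra_simps)
    moreover have "boundary k (f x) (t - m)" using L[OF agree_mono[OF _ m(2)] t] by simp
    ultimately show ?thesis using boundary_cong by blast
  qed
  then show ?thesis by blast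
qed

text \<open>An idempotent rotates by some c with 2c congruent to c, hence by zero.\<close>

lemma idempotent_same_fiber:
  assumes u: "u \<in> E" and idem: "compose X u u = u" and x: "x \<in> X"
  shows "same_fiber x (u x)"
proof (rule same_fiberI[OF x])
  fix k t assume t: "boundary k x t"
  obtain c where c: "\<And>x t. x \<in> X \<Longrightarrow> boundary k x t \<Longrightarrow> boundary k (u x) (t - c)" using residue_exists[OF u] by blast
  have "u (u x) = u x" using idem x by (metis compose_eq)
  then have "boundary k (u x) (t - c)" "boundary k (u x) (t - c - c)"
    using c[OF x t] c[OF shift_limits_in_X[OF u x], of "t - c"] by auto
  then have "[t - c = t - c - c] (mod R k)" by (rule boundary_unique)
  then have "[t - c = t] (mod R k)" by (simp add: cong_iff_dvd_diff)
  then show "boundary k (u x) t" using boundary_cong c[OF x t] by blast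
qed

lemma shift_equivariant:
  assumes f: "f \<in> E" and x: "x \<in> X"
  shows "f (shift_pow e x) = shift_pow e (f x)"
proof
  fix i
  obtain m where m: "\<forall>y\<in>{x, shift_pow e x}. agree (nat \<bar>i\<bar> + nat \<bar>e\<bar>) (f y) (shift_pow m y)"
    using shift_limitsD[OF f, of "{x, shift_pow e x}" "nat \<bar>i\<bar> + nat \<bar>e\<bar>"] x shift_in_X by auto
  then have "f (shift_pow e x) i = shift_pow m (shift_pow e x) i" "f x (i + e) = shift_pow m x (i + e)"
    unfolding agree_def by auto
  then show "f (shift_pow e x) i = shift_pow e (f x) i" by (simp add: shift_pow_def algebra_simps)
qed

text \<open>One shift follows both points, and \<epsilon> p + |i| <= \<epsilon> m pushes i + m past
  p. Comparing two values of a limit thus becomes comparing the points at one far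
  coordinate.\<close>

lemma half_witness:
  assumes f: "f \<in> half \<epsilon>" and \<epsilon>: "\<epsilon> = 1 \<or> \<epsilon> = -1" and "x \<in> X" "y \<in> X"
  shows "\<exists>m. 0 \<le> \<epsilon> * (i + m - p) \<and> f x i = x (i + m) \<and> f y i = y (i + m)"
proof -
  obtain m where m: "\<epsilon> * p + \<bar>i\<bar> \<le> \<epsilon> * m" "\<forall>z\<in>{x, y}. agree (nat \<bar>i\<bar>) (f z) (shift_pow m z)"
    using shift_limitsD[OF half_limits[OF f, of "\<epsilon> * p + \<bar>i\<bar>"], of "{x, y}" "nat \<bar>i\<bar>"] assms(3,4) by auto
  then have "f x i = x (i + m)" "f y i = y (i + m)" unfolding agree_def shift_pow_def by auto
  moreover have "0 \<le> \<epsilon> * (i + m - p)" using m(1) \<epsilon> by auto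
  ultimately show ?thesis by blast
qed

lemma half_asymptotic:
  assumes "f \<in> half \<epsilon>" "\<epsilon> = 1 \<or> \<epsilon> = -1" "x \<in> X" "y \<in> X"
    and "\<And>m. 0 \<le> \<epsilon> * (m - p) \<Longrightarrow> x m = y m"
  shows "f x = f y"
proof
  fix i
  show "f x i = f y i" using half_witness[OF assms(1-4), of i p] assms(5) by auto
qed

lemma half_differ:
  assumes "f \<in> half \<epsilon>" "\<epsilon> = 1 \<or> \<epsilon> = -1" "x \<in> X" "y \<in> X"
    and "\<And>m. 0 \<le> \<epsilon> * (m - p) \<Longrightarrow> x m \<noteq> y m"
  shows "f x i \<noteq> f y i"
proof -
  obtain m where "0 \<le> \<epsilon> * (i + m - p)" "f x i = x (i + m)" "f y i = y (i + m)"
    using half_witness[OF assms(1-4)] by blast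
  then show ?thesis using assms(5)[of "i + m"] by simp
qed

text \<open>Because \<open>u x = u (u x)\<close>, the points \<open>x\<close> and \<open>u x\<close> agree at positions tending to
  \<open>\<epsilon> * \<infinity>\<close>; lying in one fibre they are then asymptotic.\<close>

lemma idempotent_asymptotic:
  assumes u: "u \<in> half \<epsilon>" and idem: "compose X u u = u" and \<epsilon>: "\<epsilon> = 1 \<or> \<epsilon> = -1" and x: "x \<in> X"
  shows "\<exists>p. \<forall>m. 0 \<le> \<epsilon> * (m - p) \<longrightarrow> x m = u x m"
proof -
  have uE: "u \<in> E" using u half_subset_E by blast
  have ux: "u x \<in> X" using shift_limits_in_X[OF uE x] .
  have idx: "u (u x) = u x" using idem x by (metis compose_eq)
  obtain p where p: "\<And>y z m. same_fiber x y \<Longrightarrow> same_fiber x z \<Longrightarrow> 0 \<le> \<epsilon> * (m - p) \<Longrightarrow> (y m = z m \<longleftrightarrow> y p = z p)"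
    using fiber_dichotomy[OF x \<epsilon>] by blast
  have sf: "same_fiber x x" "same_fiber x (u x)"
    using idempotent_same_fiber[OF uE idem x] by (auto simp: same_fiber_def)
  obtain m where "0 \<le> \<epsilon> * (0 + m - p)" "u x 0 = x (0 + m)" "u (u x) 0 = u x (0 + m)"
    using half_witness[OF u \<epsilon> x ux, of 0 p] by blast
  then have xp: "x p = u x p" using iffD1[OF p[OF sf, of m]] idx by simp
  show ?thesis by (intro exI[of _ p] allI impI) (rule iffD2[OF p[OF sf] xp])
qed

text \<open>\<open>x\<close> and \<open>u x\<close> share their tail in direction \<epsilon>, and f
  reads only that tail.\<close>

lemma half_absorb:
  assumes u: "u \<in> half \<epsilon>" and idem: "compose X u u = u" and f: "f \<in> half \<epsilon>" and \<epsilon>: "\<epsilon> = 1 \<or> \<epsilon> = -1"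
  shows "compose X f u = f"
proof (rule extensionalityI[where A = X])
  fix x assume x: "x \<in> X"
  have "u x \<in> X" using shift_limits_in_X[OF subsetD[OF half_subset_E u] x] .
  moreover obtain p where "\<And>m. 0 \<le> \<epsilon> * (m - p) \<Longrightarrow> x m = u x m"
    using idempotent_asymptotic[OF u idem \<epsilon> x] by blast
  ultimately have "f x = f (u x)" by (intro half_asymptotic[OF f \<epsilon> x])
  then show "compose X f u x = f x" using x by (simp add: compose_eq)
qed (use f half_subset_E shift_limits_funcset in \<open>auto simp: PiE_iff\<close>)

text \<open>\<open>comp_pow f n\<close> is the power n + 1, so that all powers stay in
  \<open>half \<epsilon>\<close>; hence the exponent (s + 1)! appears below as
  \<open>fact (Suc s) - 1\<close>.\<close>

primrec comp_pow :: "((int \<Rightarrow> nat) \<Rightarrow> (int \<Rightarrow> nat)) \<Rightarrow> nat \<Rightarrow> ((int \<Rightarrow> nat) \<Rightarrow> (int \<Rightarrow> nat))" where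
  "comp_pow f 0 = f"
| "comp_pow f (Suc n) = compose X f (comp_pow f n)"

lemma comp_pow_apply: "x \<in> X \<Longrightarrow> comp_pow f n x = (f ^^ Suc n) x"
  by (induction n) (auto simp: compose_eq)

lemma comp_pow_half: "f \<in> half \<epsilon> \<Longrightarrow> comp_pow f n \<in> half \<epsilon>"
  by (induction n) (auto intro: compose_half subsetD[OF half_subset_E])

lemma half_idempotent:
  assumes f: "f \<in> half \<epsilon>" and \<epsilon>: "\<epsilon> = 1 \<or> \<epsilon> = -1" and sf: "\<And>x. x \<in> X \<Longrightarrow> same_fiber x (f x)"
  defines "u \<equiv> comp_pow f (fact (Suc s) - 1)"
  shows "compose X u u = u"
proof (rule extensionalityI[where A = X])
  have uE: "u \<in> E" using comp_pow_half[OF f] half_subset_E unfolding u_def by blast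
  then show "u \<in> extensional X" using shift_limits_funcset by (auto simp: PiE_iff)
  have fE: "f \<in> E" using f half_subset_E by blast
  define M :: nat where "M = fact (Suc s)"
  obtain M' where M': "M = Suc M'" unfolding M_def using fact_gt_zero[where 'a = nat, of "Suc s"] not0_implies_Suc by blast
  have u: "u x = (f ^^ M) x" if "x \<in> X" for x
    unfolding u_def comp_pow_apply[OF that] using M' by (simp add: M_def)
  fix x assume x: "x \<in> X"
  define V where "V = {y \<in> X. same_fiber x y}"
  obtain p where p: "\<And>y z m. same_fiber x y \<Longrightarrow> same_fiber x z \<Longrightarrow> 0 \<le> \<epsilon> * (m - p) \<Longrightarrow> (y m = z m \<longleftrightarrow> y p = z p)"
    using fiber_dichotomy[OF x \<epsilon>] by blast
  have fV: "f y \<in> V" if "y \<in> V" for y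
    using that sf[of y] shift_limits_in_X[OF fE, of y] unfolding V_def same_fiber_def by simp
  have f_eq: "f y = f z" if yz: "y \<in> V" "z \<in> V" "y p = z p" for y z
  proof (rule half_asymptotic[OF f \<epsilon>])
    show "y m = z m" if "0 \<le> \<epsilon> * (m - p)" for m
      using p[OF _ _ that, of y z] yz unfolding V_def by blast
  qed (use yz in \<open>simp_all add: V_def\<close>)
  have f_ne: "f y p \<noteq> f z p" if yz: "y \<in> V" "z \<in> V" "y p \<noteq> z p" for y z
  proof (rule half_differ[OF f \<epsilon>])
    show "y m \<noteq> z m" if "0 \<le> \<epsilon> * (m - p)" for m
      using p[OF _ _ that, of y z] yz unfolding V_def by blast
  qed (use yz in \<open>simp_all add: V_def\<close>)
  \<comment> \<open>\<open>inv_into\<close> picks some point of the fibre with letter b at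
    \<open>p\<close>. By \<open>f_eq\<close> the value does not depend on the pick, and
    \<open>f_ne\<close> makes \<rho> injective.\<close>
  define \<rho> where "\<rho> = (\<lambda>b. f (inv_into V (\<lambda>y. y p) b) p)"
  define B where "B = (\<lambda>y. y p) ` V"
  have \<rho>: "\<rho> (y p) = f y p" if y: "y \<in> V" for y
  proof -
    have "inv_into V (\<lambda>y. y p) (y p) \<in> V" "inv_into V (\<lambda>y. y p) (y p) p = y p"
      using y by (auto intro: inv_into_into f_inv_into_f[where f = "\<lambda>y. y p"])
    then show ?thesis unfolding \<rho>_def using f_eq y by metis
  qed
  have \<rho>B: "\<rho> ` B \<subseteq> B" unfolding B_def using \<rho> fV by auto
  have \<rho>inj: "inj_on \<rho> B" unfolding B_def inj_on_def using \<rho> f_ne by (metis (no_types, lifting) imageE)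
  have Bs: "B \<subseteq> {0..s}" unfolding B_def V_def using X_letter by auto
  have iter: "(f ^^ n) y \<in> V \<and> (f ^^ n) y p = (\<rho> ^^ n) (y p)" if "y \<in> V" for y n
    using that by (induction n) (auto simp: fV \<rho>[symmetric])
  have xV: "x \<in> V" using x by (simp add: V_def same_fiber_def)
  define y where "y = (f ^^ M) x"
  have y: "y \<in> V" "y p = x p"
    using iter[OF xV, of M] funpow_fact_id[OF \<rho>B \<rho>inj Bs, of "x p"] xV unfolding y_def M_def B_def by auto
  \<comment> \<open>\<open>y\<close> and \<open>x\<close> share the letter at \<open>p\<close> and
    may differ elsewhere; \<open>f\<close> identifies them, so splitting off one factor
    \<open>f\<close> turns f^M y into f^M x, which is y.\<close>
  have "(f ^^ M) y = (f ^^ M') (f y)" "(f ^^ M) x = (f ^^ M') (f x)" unfolding M' by (simp_all add: funpow_swap1)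
  then have "(f ^^ M) y = y" using f_eq[OF y(1) xV y(2)] y_def by simp
  moreover have "y \<in> X" using y(1) by (simp add: V_def)
  ultimately show "compose X u u x = u x" using x u by (simp add: compose_eq y_def)
qed (auto simp: compose_def)

text \<open>Once g is corrected to preserve fibres inside J, some power of it is an idempotent u in
  J, and every h in \<open>half \<epsilon>\<close> equals h u.\<close>

lemma ideal_contains_half:
  assumes J: "left_ideal X E J" and g: "g \<in> J" "g \<in> half \<epsilon>" and \<epsilon>: "\<epsilon> = 1 \<or> \<epsilon> = -1"
  shows "half \<epsilon> \<subseteq> J"
proof -
  have gE: "g \<in> E" using g(2) half_subset_E by blast
  obtain c where c: "\<And>k x t. x \<in> X \<Longrightarrow> boundary k x t \<Longrightarrow> boundary k (g x) (t - c k)"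
    using residue_exists[OF gE] by metis
  have cc: "[- c k = - c j] (mod R j)" if "j \<le> k" for j k
  proof -
    obtain x0 where x0: "x0 \<in> X" using aperiodic F_X by (auto simp: aperiodic_def)
    obtain t where t: "boundary k x0 t" using boundary_exists'[OF x0] by blast
    have "boundary j (g x0) (t - c k)" "boundary j (g x0) (t - c j)"
      using boundary_anti[OF that c[OF x0 t]] c[OF x0 boundary_anti[OF that t]] by auto
    from boundary_unique[OF this] show ?thesis by (simp add: cong_iff_dvd_diff algebra_simps)
  qed
  \<comment> \<open>From k on, all -c j are congruent to -c k modulo \<open>R k\<close> by
    \<open>cc\<close>, so e undoes the rotation by g at every level at once.\<close>
  obtain e where e: "\<And>n. e \<in> shift_limits ((\<lambda>k. - c k) ` {n..})" using cluster_point by blast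
  define f where "f = compose X e g"
  have eE: "e \<in> E" using e shift_limits_E by blast
  have fJ: "f \<in> J" using J eE g(1) unfolding f_def left_ideal_def by blast
  have f: "f \<in> half \<epsilon>" unfolding f_def using compose_half eE g(2) by blast
  have sf: "same_fiber x (f x)" if x: "x \<in> X" for x
  proof (rule same_fiberI[OF x])
    fix k t assume "boundary k x t"
    then have "boundary k (e (g x)) (t - c k - (- c k))"
      using cc c[OF x] shift_limits_in_X[OF gE x]
      by (intro shift_limits_residue[OF e[of k]]) auto
    then show "boundary k (f x) t" using x by (simp add: f_def compose_eq)
  qed
  define u where "u = comp_pow f (fact (Suc s) - 1)"
  have "comp_pow f n \<in> J" for n
  proof (induction n)
    case (Suc n)
    moreover have "f \<in> E" using f half_subset_E by blast
    ultimately show ?case using J unfolding left_ideal_def by simp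
  qed (simp add: fJ)
  then have uJ: "u \<in> J" by (simp add: u_def)
  have idem: "compose X u u = u" unfolding u_def using half_idempotent[OF f \<epsilon> sf] .
  show ?thesis
  proof
    fix h assume h: "h \<in> half \<epsilon>"
    have "compose X h u = h" using half_absorb[OF _ idem h \<epsilon>] comp_pow_half[OF f] by (simp add: u_def)
    moreover have "compose X h u \<in> J" using J uJ h half_subset_E unfolding left_ideal_def by blast
    ultimately show "h \<in> J" by simp
  qed
qed

lemma half_ideal: "\<epsilon> = 1 \<or> \<epsilon> = -1 \<Longrightarrow> left_ideal X E (half \<epsilon>)"
  unfolding left_ideal_def using half_nonempty[of \<epsilon>] half_subset_E[of \<epsilon>] compose_half by auto

text \<open>An arbitrary g is a limit of shifts of one sign. The factor e is taken in the half of
  that same sign: g is approximated after e and could otherwise outrun it.\<close>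

lemma ideal_meets_half:
  assumes J: "left_ideal X E J"
  shows "\<exists>\<epsilon>\<in>{1, -1}. half \<epsilon> \<subseteq> J"
proof -
  obtain g where g: "g \<in> J" "g \<in> E" using J unfolding left_ideal_def by blast
  have "UNIV = {m. 0 \<le> 1 * m} \<union> {m::int. 0 \<le> -1 * m}" by auto
  then have "g \<in> shift_limits {m. 0 \<le> 1 * m} \<or> g \<in> shift_limits {m. 0 \<le> -1 * m}"
    using g(2) by (intro shift_limits_Un) simp
  then obtain \<epsilon> :: int where \<epsilon>: "\<epsilon> = 1 \<or> \<epsilon> = -1" "g \<in> shift_limits {m. 0 \<le> \<epsilon> * m}" by blast
  obtain e where e: "e \<in> half \<epsilon>" using half_nonempty[of \<epsilon>] \<epsilon>(1) by auto
  have "compose X e g \<in> half \<epsilon>"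
    unfolding half_def
  proof (intro CollectI allI)
    fix n
    show "compose X e g \<in> shift_limits {m. n \<le> \<epsilon> * m}"
      using half_limits[OF e, of n] \<epsilon>(2) g(2)
      by (intro compose_shift_limits[where S = "{m. n \<le> \<epsilon> * m}" and S' = "\<lambda>_. {m. 0 \<le> \<epsilon> * m}"])
         (auto simp: algebra_simps)
  qed
  moreover have "compose X e g \<in> J" using J g(1) e half_subset_E unfolding left_ideal_def by blast
  ultimately show ?thesis using ideal_contains_half[OF J _ _ \<epsilon>(1)] \<epsilon>(1) by blast
qed

text \<open>Non-determinism yields two fixed points equal on the left and different at each position
  on the right. Limits to the right keep them different everywhere; limits to the left identify
  them.\<close>

lemma half_disjoint: "half 1 \<inter> half (-1) = {}"
proof (rule ccontr)
  assume "\<not> ?thesis"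
  then obtain f where f: "f \<in> half 1" "f \<in> half (-1)" by blast
  obtain z where z: "z \<in> X" using aperiodic F_X by (auto simp: aperiodic_def)
  obtain i j where ij: "z i = z j" "z (i + 1) \<noteq> z (j + 1)" using not_deterministic[OF z] by blast
  obtain x where x: "x \<in> F" "x 0 = z (i + 1)" "x (-1) = z i"
    using F_exists[OF shift_in_X[OF z, of "i + 1"]] by (auto simp: shift_pow_def)
  obtain y where y: "y \<in> F" "y 0 = z (j + 1)" "y (-1) = z j"
    using F_exists[OF shift_in_X[OF z, of "j + 1"]] by (auto simp: shift_pow_def)
  note X = F_X[OF x(1)] F_X[OF y(1)]
  have right: "x m \<noteq> y m" if "0 \<le> 1 * (m - 0)" for m
  proof -
    have "x m = W (nat m) (x 0) m" "y m = W (nat m) (y 0) m"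
      using that F_pos[OF x(1), of m "nat m"] F_pos[OF y(1), of m "nat m"] R_gt[of "nat m"] by auto
    moreover have "x 0 \<noteq> y 0" using ij(2) x(2) y(2) by simp
    ultimately show ?thesis using W_inj X_letter[OF X(1)] X_letter[OF X(2)] by metis
  qed
  have ne: "f x 0 \<noteq> f y 0" by (rule half_differ[OF f(1) _ X, where p = 0]) (use right in simp_all)
  have left: "x m = y m" if "0 \<le> -1 * (m - (-1))" for m
    using that F_neg[OF x(1), of "nat (-m)" m] F_neg[OF y(1), of "nat (-m)" m] R_gt[of "nat (-m)"]
      ij(1) x(3) y(3) by auto
  have "f x = f y" by (rule half_asymptotic[OF f(2) _ X, where p = "-1"]) (use left in simp_all)
  then show False using ne by simp
qed

lemma minimal_left_ideals_eq: "minimal_left_ideals X E = {half 1, half (-1)}"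
proof (intro equalityI subsetI)
  fix I assume "I \<in> minimal_left_ideals X E"
  then have I: "left_ideal X E I" "\<And>J. left_ideal X E J \<Longrightarrow> \<not> J \<subset> I"
    unfolding minimal_left_ideals_def by auto
  obtain \<epsilon> where \<epsilon>: "\<epsilon> \<in> {1, -1}" "half \<epsilon> \<subseteq> I" using ideal_meets_half[OF I(1)] by blast
  then have "half \<epsilon> = I" using I(2)[OF half_ideal, of \<epsilon>] by auto
  then show "I \<in> {half 1, half (-1)}" using \<epsilon>(1) by auto
next
  fix I assume "I \<in> {half 1, half (-1)}"
  then obtain \<epsilon> :: int where \<epsilon>: "\<epsilon> = 1 \<or> \<epsilon> = -1" "I = half \<epsilon>" by auto
  have "half \<epsilon> \<subseteq> J" if J: "left_ideal X E J" "J \<subset> half \<epsilon>" for J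
  proof -
    obtain g where "g \<in> J" using J(1) unfolding left_ideal_def by blast
    then show ?thesis using ideal_contains_half[OF J(1) _ _ \<epsilon>(1)] J(2) by blast
  qed
  then show "I \<in> minimal_left_ideals X E"
    unfolding minimal_left_ideals_def \<epsilon>(2) using half_ideal[OF \<epsilon>(1)] by blast
qed

lemma card_minimal_left_ideals: "card (minimal_left_ideals X E) = 2"
proof -
  have "half 1 \<noteq> half (-1)" using half_disjoint half_nonempty[of 1] by auto
  then show ?thesis by (simp add: minimal_left_ideals_eq)
qed

section \<open>Idempotents\<close>

definition column_pairs :: "nat \<Rightarrow> nat list set" where
  "column_pairs t = {[\<theta> a ! (t - 1), \<theta> a ! t] | a. a \<le> s}"

definition image_pairs :: "((int \<Rightarrow> nat) \<Rightarrow> (int \<Rightarrow> nat)) \<Rightarrow> nat list set" where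
  "image_pairs f = (\<lambda>x. [f x (-1), f x 0]) ` F"

text \<open>The letter at l is the image of x 0 or x (-1), by the sign of l, under one column of
  \<theta>^|l|; an injective column on a finite alphabet is onto.\<close>

lemma F_letters: "(\<lambda>x. x l) ` F = {0..s}"
proof
  show "(\<lambda>x. x l) ` F \<subseteq> {0..s}" using X_letter F_X by auto
  define i where "i = (if l \<ge> 0 then 0 else -1 :: int)"
  define j where "j = (if l \<ge> 0 then l else l + R (nat \<bar>l\<bar>))"
  have x: "x l = W (nat \<bar>l\<bar>) (x i) j" if "x \<in> F" for x
    using F_pos[OF that, of l "nat \<bar>l\<bar>"] F_neg[OF that, of "nat \<bar>l\<bar>" l] R_gt[of "nat \<bar>l\<bar>"]
    by (auto simp: i_def j_def)
  have "(\<lambda>a. W (nat \<bar>l\<bar>) a j) ` {0..s} = {0..s}"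
    using W_inj W_letter by (intro endo_inj_surj) (auto simp: inj_on_def)
  moreover have "(\<lambda>a. W (nat \<bar>l\<bar>) a j) ` {0..s} \<subseteq> (\<lambda>x. x l) ` F"
  proof
    fix b assume "b \<in> (\<lambda>a. W (nat \<bar>l\<bar>) a j) ` {0..s}"
    then obtain a where a: "a \<le> s" "b = W (nat \<bar>l\<bar>) a j" by auto
    obtain x where "x \<in> F" "x i = a" using F_letter[OF a(1)] unfolding i_def by (cases "l \<ge> 0") auto
    then show "b \<in> (\<lambda>x. x l) ` F" using x a(2) by force
  qed
  ultimately show "{0..s} \<subseteq> (\<lambda>x. x l) ` F" by simp
qed

lemma pairs_at_inner:
  assumes t: "t \<in> {1..<r}"
  shows "(\<lambda>x. [x (int r * l + int t - 1), x (int r * l + int t)]) ` F = column_pairs t"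
proof -
  have "[x (int r * l + int t - 1), x (int r * l + int t)] = [\<theta> (x l) ! (t - 1), \<theta> (x l) ! t]" if x: "x \<in> F" for x
  proof -
    have ev: "x (int r * l + i) = \<theta> (x l) ! nat i" if "0 \<le> i" "i < int r" for i
      using inflate_eval[of i 1 x l] F_T[OF x, of 1] that by (simp add: R_1)
    have "nat (int t - 1) = t - 1" by simp
    then show ?thesis using ev[of "int t"] ev[of "int t - 1"] t by (simp add: add_diff_eq)
  qed
  then have "(\<lambda>x. [x (int r * l + int t - 1), x (int r * l + int t)]) ` F =
      (\<lambda>a. [\<theta> a ! (t - 1), \<theta> a ! t]) ` (\<lambda>x. x l) ` F"
    unfolding image_image by (intro image_cong) auto
  also have "\<dots> = column_pairs t" unfolding F_letters column_pairs_def by auto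
  finally show ?thesis .
qed

lemma F_decimate:
  assumes "x \<in> F"
  shows "x (R k * l) = x l" and "x (R k * l - 1) = x (l - 1)"
  using inflate_first[OF F_X[OF assms], of k l] inflate_last[OF F_X[OF assms], of k l] F_T[OF assms, of k] by auto

text \<open>If r divides m, the pair straddles two blocks and canonical form replaces it by the pair
  at m / r. As m is nonzero, the descent ends inside a block.\<close>

lemma pairs_at:
  assumes "m \<noteq> 0"
  shows "\<exists>t\<in>{1..<r}. (\<lambda>x. [x (m - 1), x m]) ` F = column_pairs t"
  using assms
proof (induction "nat \<bar>m\<bar>" arbitrary: m rule: less_induct)
  case less
  define l where "l = m div int r"
  have m: "m = int r * l + m mod int r" by (simp add: l_def)
  show ?case
  proof (cases "m mod int r = 0")
    case True
    then have ml: "m = R 1 * l" using m by (simp add: R_1)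
    have "l \<noteq> 0" using less.prems ml by auto
    have "1 * \<bar>l\<bar> < int r * \<bar>l\<bar>" using r_gt_1 \<open>l \<noteq> 0\<close> by (intro mult_strict_right_mono) auto
    also have "\<dots> = \<bar>m\<bar>" by (simp add: ml R_1 abs_mult)
    finally have "nat \<bar>l\<bar> < nat \<bar>m\<bar>" by simp
    from less.hyps[OF this \<open>l \<noteq> 0\<close>]
    obtain t where t: "t \<in> {1..<r}" "(\<lambda>x. [x (l - 1), x l]) ` F = column_pairs t" by blast
    moreover have "(\<lambda>x. [x (m - 1), x m]) ` F = (\<lambda>x. [x (l - 1), x l]) ` F"
      unfolding ml by (intro image_cong) (auto simp: F_decimate simp del: One_nat_def)
    ultimately show ?thesis by auto
  next
    case False
    define t where "t = nat (m mod int r)"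
    have "0 \<le> m mod int r" "m mod int r < int r" using r_gt_1 by auto
    then have t: "int t = m mod int r" "t \<in> {1..<r}" using False by (auto simp: t_def)
    then show ?thesis using pairs_at_inner[OF t(2), of l] m by (intro bexI[of _ t]) auto
  qed
qed

lemma letter_eqI: "a \<le> s \<Longrightarrow> b \<le> s \<Longrightarrow> t < r \<Longrightarrow> \<theta> a ! t = \<theta> b ! t \<Longrightarrow> a = b"
  using bijective unfolding bijective_def by force

text \<open>Two adjacent columns of \<theta> are bijections, so their pairs form the graph of a
  permutation of the alphabet.\<close>

lemma column_pairs_determined:
  assumes "t \<in> {1..<r}" "[a, b] \<in> column_pairs t" "[c, d] \<in> column_pairs t" "a = c \<or> b = d"
  shows "a = c \<and> b = d"
  using assms letter_eqI[of _ _ t] letter_eqI[of _ _ "t - 1"] unfolding column_pairs_def by force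

lemma finite_column_pairs: "finite (column_pairs t)"
  and card_column_pairs: "t \<in> {1..<r} \<Longrightarrow> card (column_pairs t) = Suc s"
proof -
  have eq: "column_pairs t = (\<lambda>a. [\<theta> a ! (t - 1), \<theta> a ! t]) ` {0..s}" unfolding column_pairs_def by auto
  then show "finite (column_pairs t)" by simp
  assume "t \<in> {1..<r}"
  then have "inj_on (\<lambda>a. [\<theta> a ! (t - 1), \<theta> a ! t]) {0..s}" using letter_eqI[of _ _ t] by (auto simp: inj_on_def)
  then show "card (column_pairs t) = Suc s" unfolding eq by (simp add: card_image)
qed

text \<open>F is finite, so a single nonzero shift computes the central pairs of all its
  images.\<close>

lemma image_pairs_half:
  assumes f: "f \<in> half \<epsilon>" and \<epsilon>: "\<epsilon> = 1 \<or> \<epsilon> = -1"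
  shows "\<exists>t\<in>{1..<r}. image_pairs f = column_pairs t"
proof -
  obtain m where m: "1 \<le> \<epsilon> * m" "\<forall>x\<in>F. agree 1 (f x) (shift_pow m x)"
    using shift_limitsD[OF half_limits[OF f, of 1] finite_F] F_X by blast
  have "[f x (-1), f x 0] = [x (m - 1), x m]" if "x \<in> F" for x
    using m(2) that unfolding agree_def shift_pow_def by auto
  then have "image_pairs f = (\<lambda>x. [x (m - 1), x m]) ` F" unfolding image_pairs_def by (intro image_cong) auto
  moreover have "m \<noteq> 0" using m(1) by auto
  ultimately show ?thesis using pairs_at[of m] by simp
qed

lemma same_fiber_F: "x \<in> F \<Longrightarrow> y \<in> X \<Longrightarrow> same_fiber x y \<Longrightarrow> y \<in> F"
  by (simp add: F_iff same_fiber_def)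

lemma F_common_letter:
  assumes "x \<in> F" "y \<in> F" "x m = y m"
  shows "x (-1) = y (-1) \<or> x 0 = y 0"
proof -
  have le: "x i \<le> s" "y i \<le> s" for i using X_letter F_X assms(1,2) by auto
  have lt: "\<bar>m\<bar> < R (nat \<bar>m\<bar>)" using R_gt[of "nat \<bar>m\<bar>"] by simp
  show ?thesis
  proof (cases "0 \<le> m")
    case True
    then have "x m = W (nat \<bar>m\<bar>) (x 0) m" "y m = W (nat \<bar>m\<bar>) (y 0) m"
      using lt by (auto intro: F_pos assms(1,2))
    then show ?thesis using W_inj[OF le] assms(3) by metis
  next
    case False
    then have "x m = W (nat \<bar>m\<bar>) (x (-1)) (m + R (nat \<bar>m\<bar>))" "y m = W (nat \<bar>m\<bar>) (y (-1)) (m + R (nat \<bar>m\<bar>))"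
      using lt by (auto intro!: F_neg assms(1,2))
    then show ?thesis using W_inj[OF le] assms(3) by metis
  qed
qed

text \<open>On F the common tail of \<open>u x\<close> and \<open>v x\<close> gives one equal
  central letter, and the common pair set gives the other. A point where u and v differed would have
  a boundary of every level, hence be a shift of a fixed point.\<close>

lemma idempotent_determined:
  assumes u: "u \<in> half \<epsilon>" "compose X u u = u" and v: "v \<in> half \<epsilon>" "compose X v v = v"
    and \<epsilon>: "\<epsilon> = 1 \<or> \<epsilon> = -1" and eq: "image_pairs u = image_pairs v"
  shows "u = v"
proof (rule extensionalityI[where A = X])
  have E: "u \<in> E" "v \<in> E" using u(1) v(1) half_subset_E by auto
  then show "u \<in> extensional X" "v \<in> extensional X" using shift_limits_funcset by (auto simp: PiE_iff)
  have agree: "\<exists>m. u x m = v x m" if x: "x \<in> X" for x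
  proof -
    obtain p1 where p1: "\<And>m. 0 \<le> \<epsilon> * (m - p1) \<Longrightarrow> x m = u x m" using idempotent_asymptotic[OF u \<epsilon> x] by blast
    obtain p2 where p2: "\<And>m. 0 \<le> \<epsilon> * (m - p2) \<Longrightarrow> x m = v x m" using idempotent_asymptotic[OF v \<epsilon> x] by blast
    define m where "m = \<epsilon> * (\<bar>p1\<bar> + \<bar>p2\<bar>)"
    have "0 \<le> \<epsilon> * (m - p1)" "0 \<le> \<epsilon> * (m - p2)" using \<epsilon> unfolding m_def by auto
    then show ?thesis using p1 p2 by metis
  qed
  have onF: "u x = v x" if x: "x \<in> F" for x
  proof -
    have xX: "x \<in> X" using F_X x by blast
    have uF: "u x \<in> F" "v x \<in> F"
      using same_fiber_F[OF x] shift_limits_in_X[OF _ xX] idempotent_same_fiber[OF _ _ xX] E u(2) v(2) by auto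
    obtain m where "u x m = v x m" using agree[OF xX] by blast
    then have "u x (-1) = v x (-1) \<or> u x 0 = v x 0" by (rule F_common_letter[OF uF])
    moreover obtain t where t: "t \<in> {1..<r}" "image_pairs u = column_pairs t"
      using image_pairs_half[OF u(1) \<epsilon>] by blast
    moreover have "[u x (-1), u x 0] \<in> column_pairs t" "[v x (-1), v x 0] \<in> column_pairs t"
      using x t(2) eq unfolding image_pairs_def by auto
    ultimately show ?thesis using column_pairs_determined F_eqI[OF uF] by blast
  qed
  fix x assume x: "x \<in> X"
  show "u x = v x"
  proof (rule ccontr)
    assume "u x \<noteq> v x"
    then obtain i where i: "u x i \<noteq> v x i" by blast
    obtain m where m: "u x m = v x m" using agree[OF x] by blast
    have ux: "u x \<in> X" using shift_limits_in_X[OF E(1) x] .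
    have sf: "same_fiber x (u x)" "same_fiber x (v x)"
      using idempotent_same_fiber[OF E(1) u(2) x] idempotent_same_fiber[OF E(2) v(2) x] .
    have ne: "i \<noteq> m" using i m by auto
    have "\<exists>e\<in>{min i m<..max i m}. \<forall>k. boundary k x e"
    proof (rule common_boundary_exists[OF x])
      fix k t assume t: "boundary k x t" "t \<le> min i m"
      show "\<not> max i m < t + R k"
      proof
        assume "max i m < t + R k"
        moreover have "boundary k (u x) t" "boundary k (v x) t" using sf t(1) unfolding same_fiber_def by auto
        ultimately show False using block_agree[of k "u x" t "v x" m i] t(2) i m by auto
      qed
    qed (use ne in auto)
    then obtain e where e: "\<And>k. boundary k x e" by blast
    have "shift_pow e x \<in> F" unfolding F_iff using e shift_in_X[OF x] by (simp add: boundary_shift)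
    then have "shift_pow e (u x) = shift_pow e (v x)" using onF shift_equivariant E x by metis
    then show False using shift_shift[of "-e" e] \<open>u x \<noteq> v x\<close> by (metis add.left_inverse shift_0)
  qed
qed

text \<open>Shifts by r^k m keep all boundaries in the limit, and canonical form makes them bring
  the pair at m to the origin. The idempotent power can only shrink the pair set, and equal
  cardinalities exclude a proper shrinking.\<close>

lemma idempotent_exists:
  assumes t: "t \<in> {1..<r}" and \<epsilon>: "\<epsilon> = 1 \<or> \<epsilon> = -1"
  shows "\<exists>u\<in>half \<epsilon>. compose X u u = u \<and> image_pairs u = column_pairs t"
proof -
  \<comment> \<open>This gives m = t or m = t - r: in both cases position t of a block, with the
    sign of \<epsilon>.\<close>
  define l where "l = (if \<epsilon> = 1 then 0 else -1 :: int)"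
  define m where "m = int r * l + int t"
  have m: "1 \<le> \<epsilon> * m" using t \<epsilon> unfolding m_def l_def by auto
  obtain f where f: "\<And>n. f \<in> shift_limits ((\<lambda>k. R k * m) ` {n..})" using cluster_point by blast
  have half: "f \<in> half \<epsilon>"
    unfolding half_def
  proof (intro CollectI allI)
    fix n
    have "n \<le> \<epsilon> * (R k * m)" if "nat n \<le> k" for k
    proof -
      have "n \<le> R k * 1" using that R_gt[of k] by simp
      also have "\<dots> \<le> R k * (\<epsilon> * m)" using m by (intro mult_left_mono) auto
      finally show ?thesis by (simp add: algebra_simps)
    qed
    then have "(\<lambda>k. R k * m) ` {nat n..} \<subseteq> {m. n \<le> \<epsilon> * m}" by auto
    then show "f \<in> shift_limits {m. n \<le> \<epsilon> * m}" using shift_limits_mono f by blast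
  qed
  have fE: "f \<in> E" using half half_subset_E by blast
  have sf: "same_fiber x (f x)" if x: "x \<in> X" for x
  proof (rule same_fiberI[OF x])
    fix k t assume D: "boundary k x t"
    have "[R j * m = 0] (mod R k)" if "k \<le> j" for j
      using R_add[of k "j - k"] that by (simp add: cong_0_iff)
    then have "boundary k (f x) (t - 0)" using D x by (intro shift_limits_residue[OF f[of k]]) auto
    then show "boundary k (f x) t" by simp
  qed
  have fF: "f x \<in> F" if "x \<in> F" for x
    using same_fiber_F[OF that] sf shift_limits_in_X[OF fE] F_X[OF that] by blast
  have pf: "image_pairs f = column_pairs t"
  proof -
    obtain k where k: "\<forall>x\<in>F. agree 1 (f x) (shift_pow (R k * m) x)"
      using shift_limitsD[OF f[of 0] finite_F] F_X by blast
    have "[f x (-1), f x 0] = [x (m - 1), x m]" if "x \<in> F" for x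
      using k that F_decimate[OF that, of k m] unfolding agree_def shift_pow_def by auto
    then have "image_pairs f = (\<lambda>x. [x (m - 1), x m]) ` F" unfolding image_pairs_def by (intro image_cong) auto
    then show ?thesis using pairs_at_inner[OF t, of l] by (simp add: m_def)
  qed
  define u where "u = comp_pow f (fact (Suc s) - 1)"
  have u: "u \<in> half \<epsilon>" "compose X u u = u"
    unfolding u_def using comp_pow_half[OF half] half_idempotent[OF half \<epsilon> sf] by auto
  have "u x \<in> f ` F" if x: "x \<in> F" for x
  proof -
    have "(f ^^ n) x \<in> F" for n by (induction n) (auto simp: x fF)
    then show ?thesis unfolding u_def comp_pow_apply[OF F_X[OF x]] funpow.simps o_apply by blast
  qed
  then have "image_pairs u \<subseteq> image_pairs f" unfolding image_pairs_def by fastforce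
  moreover obtain t' where t': "t' \<in> {1..<r}" "image_pairs u = column_pairs t'"
    using image_pairs_half[OF u(1) \<epsilon>] by blast
  ultimately have "image_pairs u = column_pairs t"
    using pf card_subset_eq[OF finite_column_pairs, of "column_pairs t'" t] card_column_pairs t by auto
  then show ?thesis using u by blast
qed

lemma idempotents_bij:
  assumes "\<epsilon> = 1 \<or> \<epsilon> = -1"
  shows "bij_betw image_pairs (idempotents X (half \<epsilon>)) (column_pairs ` {1..<r})"
  unfolding bij_betw_def
proof
  show "inj_on image_pairs (idempotents X (half \<epsilon>))"
    unfolding inj_on_def idempotents_def using idempotent_determined[OF _ _ _ _ assms] by blast
  show "image_pairs ` idempotents X (half \<epsilon>) = column_pairs ` {1..<r}"
    unfolding idempotents_def using image_pairs_half[OF _ assms] idempotent_exists[OF _ assms] by fast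
qed

section \<open>Height and pair sets\<close>

abbreviation h :: nat where "h \<equiv> height s r \<theta>"

text \<open>As \<theta>(0) ends in 0, r - 1 is a return position of 0. So the gcd is nonzero, has
  finitely many divisors, and the \<open>Max\<close> in the height is attained.\<close>

lemma height_dvd: "\<exists>x\<in>F. x 0 = 0 \<and> h \<ge> 1 \<and> (\<forall>m\<ge>0. x m = 0 \<longrightarrow> int h dvd m)"
proof -
  define x where "x = (SOME x. x \<in> F \<and> x 0 = 0)"
  have "\<exists>x. x \<in> F \<and> x 0 = 0" using F_letter(1)[of 0] by auto
  then have "x \<in> F \<and> x 0 = 0" unfolding x_def by (rule someI_ex)
  then have x: "x \<in> F" "x 0 = 0" by auto
  define M where "M = {m::nat. m \<ge> 1 \<and> x (int m) = 0}"
  define H where "H = {m. m \<ge> 1 \<and> coprime m r \<and> m dvd Gcd M}"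
  have h: "h = Max H" unfolding height_def x_def[symmetric] Let_def M_def H_def ..
  have "x (int r - 1) = 0"
    using F_pos[OF x(1), of "int r - 1" 1] W_last[of 0 1] r_gt_1 x(2) by (simp add: R_1 del: One_nat_def block.simps)
  then have "r - 1 \<in> M" using r_gt_1 unfolding M_def by (simp add: of_nat_diff)
  then have "Gcd M \<noteq> 0" using r_gt_1 by (auto simp: Gcd_0_iff)
  then have "finite H" unfolding H_def
    by (intro finite_subset[OF _ finite_divisors_nat[of "Gcd M"]]) auto
  moreover have "1 \<in> H" by (simp add: H_def)
  ultimately have "h \<in> H" unfolding h by (intro Max_in) auto
  then have "h \<ge> 1" "h dvd Gcd M" by (auto simp: H_def)
  moreover have "int h dvd m" if "m \<ge> 0" "x m = 0" for m
  proof (cases "m = 0")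
    case False
    then have "nat m \<in> M" using that by (simp add: M_def)
    then have "h dvd nat m" using \<open>h dvd Gcd M\<close> Gcd_dvd dvd_trans by blast
    then have "int h dvd int (nat m)" by (simp only: int_dvd_int_iff)
    then show ?thesis using that(1) by simp
  qed simp
  ultimately show ?thesis using x by blast
qed

text \<open>\<theta>^k(0) ends in 0 at position r^k - 1, which is therefore divisible by h.\<close>

lemma R_cong_1: "[R k = 1] (mod int h)"
proof -
  obtain x where x: "x \<in> F" "x 0 = 0" "\<And>m. m \<ge> 0 \<Longrightarrow> x m = 0 \<Longrightarrow> int h dvd m" using height_dvd by blast
  have "x (R k - 1) = 0" using F_pos[OF x(1), of "R k - 1" k] W_last[of 0 k] x(2) R_pos[of k] by simp
  then show ?thesis using x(3)[of "R k - 1"] R_pos[of k] by (simp add: cong_iff_dvd_diff)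
qed

text \<open>Over an occurrence of a at p, the first 0 in \<theta>^l(a) lies at
  \<open>R l * p + Least P\<close>, a multiple of h, while \<open>R l\<close> is 1 modulo h. So the
  residue of a is -p, and S_i consists of the letters at positions congruent to i; hence the sign in
  its definition.\<close>

lemma letter_class_iff:
  assumes x: "x \<in> F" "\<And>m. m \<ge> 0 \<Longrightarrow> x m = 0 \<Longrightarrow> int h dvd m" and p: "p \<ge> 0"
  shows "x p \<in> letter_class s r \<theta> i \<longleftrightarrow> [p = int i] (mod int h)"
proof -
  define a where "a = x p"
  have a: "a \<le> s" unfolding a_def using X_letter F_X x(1) by blast
  define P where "P = (\<lambda>m. \<exists>k\<ge>1. m < length (subst_iter \<theta> k a) \<and> subst_iter \<theta> k a ! m = 0)"
  obtain k where k: "k \<ge> 1" "\<And>a b. a \<le> s \<Longrightarrow> b \<le> s \<Longrightarrow> \<exists>i. 0 \<le> i \<and> i < R k \<and> W k a i = b"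
    by (rule letter_in_block) blast
  obtain j where j: "0 \<le> j" "j < R k" "W k a j = 0" using k(2)[OF a, of 0] by blast
  have "nat j < r ^ k" using j(1,2) unfolding R_def by (simp add: nat_less_iff)
  then have "P (nat j)" unfolding P_def using k(1) j nth_subst_iter[OF a, of "nat j" k] length_subst_iter[OF a, of k]
    by (intro exI[of _ k]) simp
  then have "P (Least P)" by (rule LeastI)
  then obtain l where l: "Least P < r ^ l" "subst_iter \<theta> l a ! Least P = 0"
    unfolding P_def length_subst_iter[OF a] by blast
  have "int (Least P) < R l" unfolding R_def using l(1) by (rule iffD2[OF of_nat_less_iff])
  then have "x (R l * p + int (Least P)) = 0"
    using inflate_eval[of "int (Least P)" l x p] F_T[OF x(1), of l] l nth_subst_iter[OF a l(1)] by (simp add: a_def)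
  then have "int h dvd R l * p + int (Least P)" using x(2) p by simp
  then have "[R l * p + int (Least P) = 0] (mod int h)" by (simp add: cong_0_iff)
  moreover have "[R l * p + int (Least P) = 1 * p + int (Least P)] (mod int h)"
    by (intro cong_add cong_mult R_cong_1 cong_refl)
  ultimately have "[p + int (Least P) = 0] (mod int h)" by (metis cong_sym cong_trans mult_1)
  then have LP: "[int (Least P) = - p] (mod int h)" by (simp add: cong_iff_dvd_diff add.commute)
  have "letter_residue s r \<theta> a = Least P mod h" unfolding letter_residue_def P_def ..
  then have "[int (letter_residue s r \<theta> a) = int (Least P)] (mod int h)" by (simp add: zmod_int cong_def)
  then have "[int (letter_residue s r \<theta> a) = - p] (mod int h)" using LP cong_trans by blast
  then have "[int (letter_residue s r \<theta> a) = - int i] (mod int h) \<longleftrightarrow> [- p = - int i] (mod int h)"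
    using cong_sym cong_trans by blast
  also have "\<dots> \<longleftrightarrow> [p = int i] (mod int h)"
    by (metis cong_minus_minus_iff)
  finally show ?thesis using a unfolding letter_class_def a_def by simp
qed

lemma letter_position:
  assumes x: "x \<in> F" and b: "b \<le> s"
  shows "\<exists>p\<ge>0. x p = b"
proof -
  obtain k where "\<And>a b. a \<le> s \<Longrightarrow> b \<le> s \<Longrightarrow> \<exists>i. 0 \<le> i \<and> i < R k \<and> W k a i = b"
    by (rule letter_in_block) blast
  then obtain i where "0 \<le> i" "i < R k" "W k (x 0) i = b" using X_letter[OF F_X[OF x]] b by blast
  then show ?thesis using F_pos[OF x, of i k] by auto
qed

lemma letter_class_block:
  assumes a: "a \<in> letter_class s r \<theta> i" and j: "0 \<le> j" "j < R k"
  shows "W k a j \<in> letter_class s r \<theta> i' \<longleftrightarrow> [int i + j = int i'] (mod int h)"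
proof -
  obtain x where x: "x \<in> F" "\<And>m. m \<ge> 0 \<Longrightarrow> x m = 0 \<Longrightarrow> int h dvd m" using height_dvd by blast
  have "a \<le> s" using a by (simp add: letter_class_def)
  then obtain p where p: "p \<ge> 0" "x p = a" using letter_position[OF x(1)] by blast
  then have "[p = int i] (mod int h)" using letter_class_iff[OF x, of p i] a by simp
  then have "[R k * p + j = 1 * int i + j] (mod int h)" by (intro cong_add cong_mult R_cong_1 cong_refl)
  then have c: "[R k * p + j = int i + j] (mod int h)" by simp
  have "x (R k * p + j) = W k a j" using inflate_eval[OF j, of x p] F_T[OF x(1), of k] p(2) by simp
  moreover have "0 \<le> R k * p + j" using p(1) j(1) by simp
  ultimately have "W k a j \<in> letter_class s r \<theta> i' \<longleftrightarrow> [R k * p + j = int i'] (mod int h)"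
    using letter_class_iff[OF x, of "R k * p + j" i'] by simp
  also have "\<dots> \<longleftrightarrow> [int i + j = int i'] (mod int h)" using c unfolding cong_def by simp
  finally show ?thesis .
qed

lemma letter_class_exhaust:
  assumes "b \<le> s"
  shows "\<exists>i<h. b \<in> letter_class s r \<theta> i"
proof -
  obtain x where x: "x \<in> F" "h \<ge> 1" "\<And>m. m \<ge> 0 \<Longrightarrow> x m = 0 \<Longrightarrow> int h dvd m" using height_dvd by blast
  obtain p where p: "p \<ge> 0" "x p = b" using letter_position[OF x(1) assms] by blast
  have "int (nat (p mod int h)) = p mod int h" using x(2) by simp
  then have "b \<in> letter_class s r \<theta> (nat (p mod int h))"
    using letter_class_iff[OF x(1,3) p(1), of "nat (p mod int h)"] p(2) by (simp add: cong_def)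
  moreover have "nat (p mod int h) < h" using x(2) by (simp add: nat_less_iff)
  ultimately show ?thesis by blast
qed

section \<open>Pair sets and the columns of \<phi>\<close>

lemma pair_set_eq:
  assumes "j + 2 \<le> r ^ k"
  shows "pair_set s r \<theta> i j k = {[W k a (int j), W k a (int j + 1)] | a. a \<in> letter_class s r \<theta> i}"
proof -
  have "subst_iter \<theta> k a ! j = W k a (int j) \<and> subst_iter \<theta> k a ! (j + 1) = W k a (int j + 1)"
    if "a \<in> letter_class s r \<theta> i" for a
    using that assms nth_subst_iter[of a j k] nth_subst_iter[of a "j + 1" k]
    by (simp add: letter_class_def add.commute)
  then show ?thesis unfolding pair_set_def by force
qed

lemma F_legal_pair:
  assumes "x \<in> F"
  shows "[x (-1), x 0] \<in> legal_pairs s \<theta>"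
proof -
  have "subword x (-1) 2 = [x (-1), x 0]" by (simp add: subword_def numeral_2_eq_2)
  then show ?thesis unfolding legal_pairs_def legal_def using F_X[OF assms]
    by (auto intro!: bexI[of _ x] exI[of _ "-1"] simp: numeral_2_eq_2)
qed

text \<open>The index of the pair of a at column t depends only on the letter class of a, and the
  choice \<open>c\<close> meets every class. For injectivity, \<open>column_pairs t\<close> is a
  union of whole sets P m, so its indices recover it.\<close>

lemma column_sets_bij:
  assumes part: "pair_sets_partition s r \<theta>" and lab: "pair_labelling s r \<theta> N P" and ch: "last_letter_choice N P c"
  shows "\<And>t. t \<in> {1..<r} \<Longrightarrow> column_set r \<theta> N P c t = pair_index N P ` column_pairs t"
    and "inj_on (image (pair_index N P)) (column_pairs ` {1..<r})"
proof -
  let ?idx = "pair_index N P"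
  have bij: "bij_betw P {..<N} (pair_sets s r \<theta>)" using lab by (simp add: pair_labelling_def)
  have idx: "?idx w = m" if m: "m < N" "w \<in> P m" for w m
    unfolding pair_index_def
  proof (rule the_equality)
    fix m' assume m': "m' < N \<and> w \<in> P m'"
    then have "P m \<in> pair_sets s r \<theta>" "P m' \<in> pair_sets s r \<theta>" "\<not> disjnt (P m) (P m')"
      using bij m by (auto simp: bij_betw_def disjnt_iff)
    then have "P m = P m'" using part unfolding pair_sets_partition_def pairwise_def by blast
    then show "m' = m" using bij m(1) m' unfolding bij_betw_def by (auto dest: inj_onD)
  qed (use m in auto)
  have label: "\<exists>m<N. S = P m" if "S \<in> pair_sets s r \<theta>" for S
    using bij that unfolding bij_betw_def by auto
  have column: "\<exists>i<h. a \<in> letter_class s r \<theta> i \<and> pair_set s r \<theta> i (t - 1) 1 \<in> pair_sets s r \<theta>"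
    if ta: "t \<in> {1..<r}" "a \<le> s" for t a
  proof -
    obtain i where "i < h" "a \<in> letter_class s r \<theta> i" using letter_class_exhaust[OF ta(2)] by blast
    moreover have "t - 1 + 2 \<le> r ^ 1" using ta(1) by auto
    ultimately show ?thesis unfolding pair_sets_def by blast
  qed
  have theta: "subst_iter \<theta> 1 a = \<theta> a" for a by (simp add: subst_iter_Suc subst_iter_0)
  have column_mem: "[\<theta> a ! (t - 1), \<theta> a ! t] \<in> pair_set s r \<theta> i (t - 1) 1"
    if "t \<in> {1..<r}" "a \<in> letter_class s r \<theta> i" for t a i
    using that unfolding pair_set_def theta by auto
  have column_sub: "pair_set s r \<theta> i (t - 1) 1 \<subseteq> column_pairs t" if "t \<in> {1..<r}" for t i
    using that unfolding pair_set_def theta column_pairs_def letter_class_def by auto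
  show "column_set r \<theta> N P c t = ?idx ` column_pairs t" if t: "t \<in> {1..<r}" for t
  proof -
    have nth: "pair_subst r \<theta> N P c b ! t = ?idx [\<theta> (c b) ! (t - 1), \<theta> (c b) ! t]" for b
      using t unfolding pair_subst_def by (cases t) (auto simp: nth_map_upt simp del: upt_Suc)
    have block: "\<exists>i j k. i < h \<and> j + 2 \<le> r ^ k \<and> P b = {[W k a (int j), W k a (int j + 1)] | a. a \<in> letter_class s r \<theta> i}"
      if "b < N" for b
    proof -
      have "P b \<in> pair_sets s r \<theta>" using bij that unfolding bij_betw_def by auto
      then obtain i j k where ijk: "i < h" "j + 2 \<le> r ^ k" "P b = pair_set s r \<theta> i j k"
        unfolding pair_sets_def by blast
      then show ?thesis using pair_set_eq[OF ijk(2), of i] by auto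
    qed
    have bound: "int j + 1 < R k" if "j + 2 \<le> r ^ k" for j k
    proof -
      have "int (j + 1) < int (r ^ k)" using that by (intro iffD2[OF of_nat_less_iff]) simp
      then show ?thesis by (simp add: R_def)
    qed
    have c_letter: "c b \<le> s" if b: "b < N" for b
    proof -
      have "c b \<in> last ` P b" using ch b by (simp add: last_letter_choice_def)
      moreover obtain i j k where "P b = {[W k a (int j), W k a (int j + 1)] | a. a \<in> letter_class s r \<theta> i}"
        using block[OF b] by blast
      ultimately show ?thesis using W_letter by (auto simp: letter_class_def)
    qed
    have "\<exists>b<N. ?idx [\<theta> a ! (t - 1), \<theta> a ! t] = ?idx [\<theta> (c b) ! (t - 1), \<theta> (c b) ! t]" if a: "a \<le> s" for a
    proof -
      obtain x where x: "x \<in> F" "x 0 = a" using F_letter(1)[OF a] by blast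
      \<comment> \<open>The partition covers the legal pair ending in a; this yields the index b
        whose chosen letter is compared with a.\<close>
      have "[x (-1), x 0] \<in> \<Union> (pair_sets s r \<theta>)"
        using F_legal_pair[OF x(1)] part by (simp add: pair_sets_partition_def)
      then obtain b where b: "b < N" "[x (-1), a] \<in> P b" using label x(2) by blast
      obtain i j k where i: "j + 2 \<le> r ^ k"
        "P b = {[W k a (int j), W k a (int j + 1)] | a. a \<in> letter_class s r \<theta> i}"
        using block[OF b(1)] by blast
      obtain a1 where a1: "a1 \<in> letter_class s r \<theta> i" "a = W k a1 (int j + 1)"
        using b(2) unfolding i(2) by auto
      have "c b \<in> last ` P b" using ch b(1) by (simp add: last_letter_choice_def)
      then obtain a2 where a2: "a2 \<in> letter_class s r \<theta> i" "c b = W k a2 (int j + 1)"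
        unfolding i(2) by auto
      obtain i' where i': "a \<in> letter_class s r \<theta> i'" "pair_set s r \<theta> i' (t - 1) 1 \<in> pair_sets s r \<theta>"
        using column[OF t a] by blast
      \<comment> \<open>Both \<open>a\<close> and \<open>c b\<close> are letter j + 1 of blocks of
        level k over the class with index i, so their classes coincide.\<close>
      have "c b \<in> letter_class s r \<theta> i'"
        using i'(1) letter_class_block[OF a1(1) _ bound[OF i(1)], of i'] letter_class_block[OF a2(1) _ bound[OF i(1)], of i']
        unfolding a1(2) a2(2) by simp
      then have "[\<theta> (c b) ! (t - 1), \<theta> (c b) ! t] \<in> pair_set s r \<theta> i' (t - 1) 1"
        "[\<theta> a ! (t - 1), \<theta> a ! t] \<in> pair_set s r \<theta> i' (t - 1) 1"
        using column_mem[OF t] i'(1) by auto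
      moreover obtain m where "m < N" "pair_set s r \<theta> i' (t - 1) 1 = P m" using label[OF i'(2)] by blast
      ultimately have "?idx [\<theta> a ! (t - 1), \<theta> a ! t] = ?idx [\<theta> (c b) ! (t - 1), \<theta> (c b) ! t]"
        using idx by simp
      then show ?thesis using b(1) by blast
    qed
    then have "?idx w \<in> column_set r \<theta> N P c t" if "w \<in> column_pairs t" for w
      using that unfolding column_set_def nth column_pairs_def by auto
    moreover have "[\<theta> (c b) ! (t - 1), \<theta> (c b) ! t] \<in> column_pairs t" if "b < N" for b
      using c_letter[OF that] unfolding column_pairs_def by blast
    ultimately show ?thesis unfolding column_set_def nth by auto
  qed
  have sub: "column_pairs t \<subseteq> column_pairs t'"
    if t: "t \<in> {1..<r}" "t' \<in> {1..<r}" and eq: "?idx ` column_pairs t = ?idx ` column_pairs t'" for t t'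
  proof
    have blk: "\<exists>m<N. w \<in> P m \<and> P m \<subseteq> column_pairs t" if t: "t \<in> {1..<r}" and w: "w \<in> column_pairs t" for w t
    proof -
      obtain a where a: "a \<le> s" "w = [\<theta> a ! (t - 1), \<theta> a ! t]" using w by (auto simp: column_pairs_def)
      obtain i where i: "a \<in> letter_class s r \<theta> i" "pair_set s r \<theta> i (t - 1) 1 \<in> pair_sets s r \<theta>"
        using column[OF t a(1)] by blast
      then show ?thesis using label[OF i(2)] column_mem[OF t i(1)] column_sub[OF t, of i] a(2) by auto
    qed
    fix w assume w: "w \<in> column_pairs t"
    then obtain w' where w': "w' \<in> column_pairs t'" "?idx w = ?idx w'" using eq by blast
    obtain m where m: "m < N" "w \<in> P m" using blk[OF t(1) w] by blast
    obtain m' where m': "m' < N" "w' \<in> P m'" "P m' \<subseteq> column_pairs t'" using blk[OF t(2) w'(1)] by blast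
    show "w \<in> column_pairs t'" using idx[OF m] idx[OF m'(1,2)] w'(2) m m' by auto
  qed
  show "inj_on (image ?idx) (column_pairs ` {1..<r})"
  proof (rule inj_onI)
    fix S S' assume "S \<in> column_pairs ` {1..<r}" "S' \<in> column_pairs ` {1..<r}" "?idx ` S = ?idx ` S'"
    then show "S = S'" using sub by (elim imageE) (simp add: subset_antisym)
  qed
qed

end

theorem theorem51:
  fixes s r n N :: nat
    and \<theta> :: "nat \<Rightarrow> nat list"
    and P :: "nat \<Rightarrow> nat list set"
    and c :: "nat \<Rightarrow> nat"
  assumes "substitution s \<theta>"
    and "constant_length s r \<theta>"
    and "primitive s \<theta>"
    and "aperiodic s r \<theta>"
    and "bijective s r \<theta>"
    and "canonical_form s r \<theta>"
    and "card (fixed_points s r \<theta>) = n"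
    and "pair_sets_partition s r \<theta>"
    and "pair_labelling s r \<theta> N P"
    and "last_letter_choice N P c"
  defines "X \<equiv> subst_space s \<theta>"
  defines "E \<equiv> ellis_semigroup X shift_pow"
  defines "q \<equiv> card {column_set r \<theta> N P c i | i. 1 \<le> i \<and> i \<le> r - 1}"
  shows "card (minimal_left_ideals X E) = 2 \<and>
    (\<forall>I\<in>minimal_left_ideals X E. finite (idempotents X I) \<and> card (idempotents X I) = q)"
proof -
  interpret canonical_bijective_substitution s r \<theta>
    by (rule canonical_bijective_substitution.intro[OF assms(1-6)])
  let ?C = "column_pairs ` {1..<r}"
  have E: "E = shift_limits UNIV" by (simp add: E_def X_def ellis_semigroup_eq)
  note bij = column_sets_bij[OF assms(8-10)]
  have "{column_set r \<theta> N P c i | i. 1 \<le> i \<and> i \<le> r - 1} = column_set r \<theta> N P c ` {1..<r}"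
  proof -
    have "{1..<r} = {i. 1 \<le> i \<and> i \<le> r - 1}" using r_gt_1 by auto
    then show ?thesis by blast
  qed
  also have "\<dots> = image (pair_index N P) ` ?C" unfolding image_image using bij(1) by (intro image_cong) auto
  finally have q: "q = card ?C" unfolding q_def using card_image[OF bij(2)] by simp
  have "finite (idempotents X I) \<and> card (idempotents X I) = q" if I: "I \<in> minimal_left_ideals X E" for I
  proof -
    obtain \<epsilon> :: int where \<epsilon>: "\<epsilon> = 1 \<or> \<epsilon> = -1" "I = half \<epsilon>"
      using I unfolding E X_def minimal_left_ideals_eq by blast
    have b: "bij_betw image_pairs (idempotents X I) ?C" unfolding X_def \<epsilon>(2) by (rule idempotents_bij[OF \<epsilon>(1)])
    show ?thesis using bij_betw_finite[OF b] bij_betw_same_card[OF b] q by simp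
  qed
  moreover have "card (minimal_left_ideals X E) = 2" unfolding E X_def by (rule card_minimal_left_ideals)
  ultimately show ?thesis by blast
qed

end
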